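(* Let $\Omega\subseteq S^2$ with $|\partial\Omega|=0$, let $f\in L^1(\bar\Omega)$ with $f>0$ a.e., let $g_1,\dots,g_N>0$ with $N>1$, let $D=\{P_1,\dots,P_N\}\subset\mathbb{R}^3$ be a set of $N$ distinct points with $O\notin D$, $M=\max_i OP_i$, and $\eta=\sum_{i=1}^N g_i\delta_{P_i}$. Let $\delta>0$, $c_\delta=-\delta+\sqrt{1+\delta^2}$, $k\ge\frac{1+c_\delta}{1-c_\delta}$, and suppose $\int_{\bar\Omega}f\,dx\ge\frac{1}{C}\,\eta(D)$ with $C=\frac{(1-c_\delta)^3}{(1+c_\delta)(k\delta M)^2}$. Let $$W=\{w=(d_1,\dots,d_N):\ d_1=k\delta M,\ d_i\ge\delta M,\ \mu_w(P_i)\le g_i\ \text{for }2\le i\le N\},$$ $$\mathcal C=\{w=(d_1,\dots,d_N):\ d_1=k\delta M,\ d_i\ge\delta M,\ \mu_w(P_i)=g_i\ \text{for }2\le i\le N\},$$ and let $\bar w=(\bar d_1,\dots,\bar d_N)$ with $\bar d_1=k\delta M$ and $\bar d_i=\inf_{w\in W}d_i$ for $2\le i\le N$, with reflector measure $\bar\mu=\mu_{\bar w}$. If $w=(d_1,\dots,d_N)\in\mathcal C$ and $\mu=\mu_w$ is its reflector measure, then $$\bar\mu(D)\le\mu(D).$$ Moreover, if $\bar\Omega$ is connected and $\bar\mu(D)=\mu(D)$, then $\bar d_i=d_i$ for all $1\le i\le N$.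
   Context: $S^2$ is the unit sphere of $\mathbb{R}^3$ centered at the origin $O$; $dx$ and $|\cdot|$ denote surface (Lebesgue) measure on $S^2$; $\bar\Omega$, $\partial\Omega$ are closure and boundary in $S^2$. For $P\ne O$ write $OP=|P|$ and $m_P=P/|P|$. For $d>0$, $E_d(P)$ is the ellipsoid of revolution with foci $O$ and $P$ with polar radius $\rho_d(x)=\frac{d}{1-\varepsilon\,x\cdot m_P}$, $x\in S^2$, where $\varepsilon=\sqrt{1+\frac{d^2}{OP^2}}-\frac{d}{OP}\in(0,1)$ is its eccentricity ($\rho_d$ also depends on $P$). For $w=(d_1,\dots,d_N)$ with $d_i>0$, $\rho_w(x)=\min_{1\le i\le N}\rho_{d_i}(x)$, where $\rho_{d_i}$ is the polar radius of $E_{d_i}(P_i)$; the associated reflector is $\sigma_w=\{\rho_w(x)x\}_{x\in\bar\Omega}$. For $P\in D$, $\tau_{\sigma_w}(P)$ is the set of $x_0\in\bar\Omega$ such that some ellipsoid $E_d(P)$ supports $\sigma_w$ at $\rho_w(x_0)x_0$, i.e. $\rho_w\le\rho_d$ on $\bar\Omega$ with equality at $x_0$; $\tau_{\sigma_w}(E)=\bigcup_{P\in E}\tau_{\sigma_w}(P)$. The reflector measure of $w$ is $$\mu_w(E)=\int_{\tau_{\sigma_w}(E)}f(x)\,\frac{x\cdot\nu_w(x)}{\rho_w(x)^2}\,dx,\qquad E\subseteq D,$$ where $\nu_w(x)$ is the outer unit normal to $\sigma_w$ at $\rho_w(x)x$ (defined for a.e. $x$; a.e. it equals $\frac{x-\varepsilon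 m_P}{|x-\varepsilon m_P|}$ with $E_d(P)$ the supporting ellipsoid at that point and $\varepsilon$ its eccentricity). $\mu_w(P_i)$ means $\mu_w(\{P_i\})$.
   Formalization: In the "Moreover" part, Ω is additionally assumed to be contained in the closure of its interior in S² (true for every open Ω); without this the claim fails, e.g. for N=3 and Ω three small discs joined by arcs of measure zero. *)

theory Defs
  imports "HOL-Analysis.Analysis"
begin

abbreviation S2 :: "(real^3) set" where
  "S2 \<equiv> sphere 0 1"

(* Surface measure on the unit sphere as the normalized cone measure: a Borel set A of
   directions has area 3 times the volume of the cone {y. 0 < norm y <= 1, sgn y : A}
   (sgn y = y / norm y).  The completion adds the Lebesgue measurable sets. *)
definition sphere_measure :: "(real^3) measure" where
  "sphere_measure = completion (scale_measure 3
     (distr (restrict_space lborel (cball 0 1 - {0})) (restrict_space borel S2) sgn))"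

definition eccentricity :: "real \<Rightarrow> real^3 \<Rightarrow> real" where
  "eccentricity d P = sqrt (1 + d\<^sup>2 / (norm P)\<^sup>2) - d / norm P"

(* Polar radius of the ellipsoid E_d(P) with foci 0 and P; m_P is sgn P. *)
definition polar_radius :: "real \<Rightarrow> real^3 \<Rightarrow> real^3 \<Rightarrow> real" where
  "polar_radius d P x = d / (1 - eccentricity d P * (x \<bullet> sgn P))"

definition ellipsoid :: "real \<Rightarrow> real^3 \<Rightarrow> (real^3) set" where
  "ellipsoid d P = (\<lambda>x. polar_radius d P x *\<^sub>R x) ` S2"

(* Families (P_1,...,P_N), (d_1,...,d_N) are functions on nat of which only the values
   on {1..N} are used. *)
definition reflector_radius :: "nat \<Rightarrow> (nat \<Rightarrow> real^3) \<Rightarrow> (nat \<Rightarrow> real) \<Rightarrow> real^3 \<Rightarrow> real" where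
  "reflector_radius N P w x = Min ((\<lambda>i. polar_radius (w i) (P i) x) ` {1..N})"

(* closure is the closure in real^3; for subsets of the sphere it is the closure in the sphere. *)
definition reflector ::
  "(real^3) set \<Rightarrow> nat \<Rightarrow> (nat \<Rightarrow> real^3) \<Rightarrow> (nat \<Rightarrow> real) \<Rightarrow> (real^3) set" where
  "reflector \<Omega> N P w = (\<lambda>x. reflector_radius N P w x *\<^sub>R x) ` closure \<Omega>"

(* E_d(Q) supports the reflector at the point in direction x0. *)
definition supports ::
  "(real^3) set \<Rightarrow> nat \<Rightarrow> (nat \<Rightarrow> real^3) \<Rightarrow> (nat \<Rightarrow> real) \<Rightarrow> real \<Rightarrow> real^3 \<Rightarrow> real^3 \<Rightarrow> bool" where
  "supports \<Omega> N P w d Q x0 \<longleftrightarrow>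
     (\<forall>x\<in>closure \<Omega>. reflector_radius N P w x \<le> polar_radius d Q x) \<and>
     reflector_radius N P w x0 = polar_radius d Q x0"

definition tracing_map ::
  "(real^3) set \<Rightarrow> nat \<Rightarrow> (nat \<Rightarrow> real^3) \<Rightarrow> (nat \<Rightarrow> real) \<Rightarrow> real^3 \<Rightarrow> (real^3) set" where
  "tracing_map \<Omega> N P w Q = {x0 \<in> closure \<Omega>. \<exists>d>0. supports \<Omega> N P w d Q x0}"

(* nu is orthogonal to the surface S at p (to first order) and points away from the origin. *)
definition is_outer_unit_normal :: "(real^3) set \<Rightarrow> real^3 \<Rightarrow> real^3 \<Rightarrow> bool" where
  "is_outer_unit_normal S p \<nu> \<longleftrightarrow> norm \<nu> = 1 \<and> 0 < p \<bullet> \<nu> \<and>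
     ((\<lambda>y. ((y - p) \<bullet> \<nu>) / norm (y - p)) \<longlongrightarrow> 0) (at p within S)"

(* At the negligible set of directions where the reflector has no unique normal the value
   is unspecified. *)
definition reflector_normal ::
  "(real^3) set \<Rightarrow> nat \<Rightarrow> (nat \<Rightarrow> real^3) \<Rightarrow> (nat \<Rightarrow> real) \<Rightarrow> real^3 \<Rightarrow> real^3" where
  "reflector_normal \<Omega> N P w x =
     (THE \<nu>. is_outer_unit_normal (reflector \<Omega> N P w) (reflector_radius N P w x *\<^sub>R x) \<nu>)"

definition reflector_measure ::
  "(real^3) set \<Rightarrow> (real^3 \<Rightarrow> real) \<Rightarrow> nat \<Rightarrow> (nat \<Rightarrow> real^3) \<Rightarrow> (nat \<Rightarrow> real) \<Rightarrow> (real^3) set \<Rightarrow> real"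
  where
  "reflector_measure \<Omega> f N P w E =
     (LINT x:(\<Union>Q\<in>E. tracing_map \<Omega> N P w Q)|sphere_measure.
        f x * ((x \<bullet> reflector_normal \<Omega> N P w x) / (reflector_radius N P w x)\<^sup>2))"

(* The discrete measure \<Sum>i. g_i \<delta>_{P_i}. *)
definition target_measure ::
  "nat \<Rightarrow> (nat \<Rightarrow> real) \<Rightarrow> (nat \<Rightarrow> real^3) \<Rightarrow> (real^3) set \<Rightarrow> real" where
  "target_measure N g P E = (\<Sum>i=1..N. g i * indicator E (P i))"


text \<open>Consistency of the conventions: the total area of the sphere is \<open>4 \<pi>\<close>, and
  \<open>polar_radius\<close> does describe an ellipsoid of revolution with foci \<open>0\<close> and \<open>P\<close>.\<close>

lemma emeasure_sphere_measure:
  assumes "A \<in> sets (restrict_space borel S2)"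
  shows "emeasure sphere_measure A = 3 * emeasure lborel {y. norm y \<le> 1 \<and> y \<noteq> 0 \<and> sgn y \<in> A}"
proof -
  let ?R = "restrict_space lborel (cball 0 1 - {0}) :: (real^3) measure"
  have cs: "cball 0 1 - {0} \<in> sets (lborel :: (real^3) measure)" by simp
  have m: "sgn \<in> ?R \<rightarrow>\<^sub>M restrict_space borel S2"
  proof (rule measurable_restrict_space2)
    show "sgn \<in> space ?R \<rightarrow> S2"
      by (auto simp: space_restrict_space norm_sgn)
    have "(\<lambda>y::real^3. y /\<^sub>R norm y) \<in> borel_measurable borel" by measurable
    then show "sgn \<in> borel_measurable ?R"
      unfolding sgn_div_norm by (intro measurable_restrict_space1) simp
  qed
  have A': "A \<in> sets (scale_measure 3 (distr ?R (restrict_space borel S2) sgn))"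
    using assms by simp
  have "emeasure sphere_measure A = 3 * emeasure ?R (sgn -` A \<inter> space ?R)"
    unfolding sphere_measure_def using A' assms m
    by (simp add: emeasure_completion main_part_sets emeasure_distr)
  also have "emeasure ?R (sgn -` A \<inter> space ?R) = emeasure lborel (sgn -` A \<inter> space ?R)"
    using cs by (intro emeasure_restrict_space) (auto simp: space_restrict_space)
  also have "sgn -` A \<inter> space ?R = {y. norm y \<le> 1 \<and> y \<noteq> 0 \<and> sgn y \<in> A}"
    by (auto simp: space_restrict_space)
  finally show ?thesis .
qed

lemma emeasure_sphere_measure_S2: "emeasure sphere_measure S2 = ennreal (4 * pi)"
proof -
  have "{y::real^3. norm y \<le> 1 \<and> y \<noteq> 0 \<and> sgn y \<in> S2} = cball 0 1 - {0}"
    by (auto simp: norm_sgn)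
  moreover have "S2 \<in> sets (restrict_space borel S2)"
    using sets.top[of "restrict_space borel S2"] by (simp add: space_restrict_space)
  moreover have "emeasure lborel (cball 0 1 - {0::real^3}) = emeasure lborel (cball (0::real^3) 1)"
    by (intro emeasure_Diff_null_set) auto
  ultimately have "emeasure sphere_measure S2 = 3 * ennreal (unit_ball_vol 3)"
    by (simp add: emeasure_sphere_measure emeasure_cball)
  then show ?thesis
    by (simp add: unit_ball_vol_3 flip: ennreal_numeral ennreal_mult)
qed

lemma ellipsoid_focal_sum:
  assumes "P \<noteq> 0" "d > 0" "y \<in> ellipsoid d P"
  shows "norm y + norm (y - P) = norm P / eccentricity d P"
proof -
  define p where "p = norm P"
  define e where "e = eccentricity d P"
  have p: "p > 0" using assms by (simp add: p_def)
  obtain x where x: "norm x = 1" "y = polar_radius d P x *\<^sub>R x"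
    using assms by (auto simp: ellipsoid_def)
  define c where "c = x \<bullet> sgn P"
  have c: "\<bar>c\<bar> \<le> 1"
    using Cauchy_Schwarz_ineq2[of x "sgn P"] x assms by (simp add: c_def norm_sgn)
  have xP: "x \<bullet> P = p * c"
    using p by (simp add: c_def p_def sgn_div_norm)
  have e_sqrt: "e + d / p = sqrt (1 + (d / p)\<^sup>2)"
    by (simp add: e_def eccentricity_def p_def power_divide)
  have "d / p < sqrt (1 + (d / p)\<^sup>2)" by (rule real_less_rsqrt) simp
  then have e0: "e > 0" using e_sqrt by simp
  have "(e + d / p)\<^sup>2 = 1 + (d / p)\<^sup>2" unfolding e_sqrt by simp
  then have "e\<^sup>2 + 2 * e * (d / p) = 1" by (simp add: power2_sum)
  then have eq: "2 * e * d = p * (1 - e\<^sup>2)" using p by (simp add: field_simps)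
  have "0 < 2 * e * d" using e0 assms by simp
  then have "e\<^sup>2 < 1" using p unfolding eq by (simp add: zero_less_mult_iff)
  then have e1: "e < 1" using e0 by (simp add: power2_eq_1_iff abs_square_less_1)
  have "e * c \<le> e" using c e0 by (simp add: abs_le_iff)
  then have pos: "1 - e * c \<ge> 1 - e" "1 - e * c > 0" using e1 by auto
  define r where "r = polar_radius d P x"
  have r: "r * (1 - e * c) = d" using pos
    by (simp add: r_def polar_radius_def e_def[symmetric] c_def[symmetric])
  have r0: "r > 0" using r pos assms by (metis zero_less_mult_pos2)
  have "r * (1 - e) \<le> d" using r pos r0 by (metis mult_le_cancel_left_pos)
  then have "2 * e * (r * (1 - e)) \<le> p * (1 - e\<^sup>2)" using e0 unfolding eq[symmetric] by simp
  also have "p * (1 - e\<^sup>2) = (p * (1 + e)) * (1 - e)" by (simp add: power2_eq_square algebra_simps)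
  finally have "2 * e * r \<le> p * (1 + e)" using e1 by (simp add: mult.assoc[symmetric])
  also have "\<dots> \<le> p * 2" using e1 p by simp
  finally have ge: "0 \<le> p / e - r" using e0 by (simp add: field_simps)
  have "(norm (y - P))\<^sup>2 = r\<^sup>2 - 2 * r * (p * c) + p\<^sup>2"
  proof -
    have "x \<bullet> x = 1" using x(1) by (simp add: norm_eq_1)
    then show ?thesis using xP unfolding x(2) r_def[symmetric] p_def power2_norm_eq_inner
      by (simp add: inner_diff inner_commute power2_eq_square algebra_simps)
  qed
  also have "\<dots> = (p / e - r)\<^sup>2"
  proof -
    have "p\<^sup>2 * (1 - e\<^sup>2) = 2 * e * p * (r * (1 - e * c))"
      using eq r by (simp add: power2_eq_square mult_ac)
    then show ?thesis using e0 by (simp add: field_simps power2_eq_square)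
  qed
  finally have "norm (y - P) = p / e - r" using ge by (simp add: power2_eq_iff_nonneg)
  moreover have "norm y = r" using x r0 by (simp add: r_def[symmetric])
  ultimately show ?thesis by (simp add: p_def e_def)
qed

end

theory Submission
  imports Defs
begin

text \<open>Two ellipsoids with distinct second foci meet over a circle of directions, a null set. Hence,
  almost everywhere, the directions traced to \<open>P i\<close> form the cell where the i-th ellipsoid realises
  the minimum, and on this cell the integrand depends on \<open>w i\<close> alone. Polar radii increase with
  their parameter, so lowering the other parameters shrinks the i-th cell; therefore \<open>W\<close> is
  closed under coordinatewise minima and, by dominated convergence, contains its infimum
  \<open>dbar\<close>. As \<open>dbar \<le> d\<close> with equality in the first coordinate, every point receives at most
  as much mass from \<open>dbar\<close> as from \<open>d\<close>. If the totals agree, all these masses agree, and a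
  connectedness argument shows that no parameter can have dropped. The energy condition is
  needed to give \<open>P 1\<close> positive mass.\<close>

text \<open>The mass at \<open>P i\<close> is not monotone in \<open>w i\<close> in any evident way,
  since both the cell and the integrand move with it. Comparisons are therefore made only at an
  index where two parameter vectors agree. A coordinatewise minimum is well suited to this: at every
  index it agrees with one of its two arguments. A second obstacle is the encoding. The normal is a
  definite description and the tracing sets have no evident measurability, so
  \<open>reflector_measure\<close> is first rewritten as a sum of integrals of the explicit
  functions \<open>density\<close>; completeness of \<open>sphere_measure\<close> makes this
  legitimate. The equality case needs every nonempty relatively open subset of
  \<open>closure \<Omega>\<close> to be non-null. A null frontier does not ensure this: two disjoint
  closed caps joined by an arc form a connected closed set, yet a short piece of the arc is
  relatively open and null. Hence the second claim assumes that \<Omega> lies in the closure of its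
  interior, both taken in the sphere.\<close>

section \<open>Eccentricity and polar radius of one ellipsoid\<close>

text \<open>Squaring removes the root: the eccentricity is the positive solution of a quadratic. The
  two comparison results below work from this relation instead of the square root.\<close>

lemma eccentricity_equation:
  assumes "Q \<noteq> 0" "d > 0"
  shows "(eccentricity d Q)\<^sup>2 + 2 * eccentricity d Q * (d / norm Q) = 1"
    "eccentricity d Q > 0" "eccentricity d Q < 1"
proof -
  define t where "t = d / norm Q"
  have t: "t > 0" using assms by (simp add: t_def)
  have e: "eccentricity d Q = sqrt (1 + t\<^sup>2) - t"
    by (simp add: eccentricity_def t_def power_divide)
  have "(eccentricity d Q + t)\<^sup>2 = 1 + t\<^sup>2" unfolding e by simp
  then show eq: "(eccentricity d Q)\<^sup>2 + 2 * eccentricity d Q * (d / norm Q) = 1"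
    unfolding t_def[symmetric] by (simp add: power2_sum)
  have "t < sqrt (1 + t\<^sup>2)" by (rule real_less_rsqrt) simp
  then show pos: "eccentricity d Q > 0" by (simp add: e)
  have "0 < eccentricity d Q * (d / norm Q)"
    using pos t unfolding t_def by (rule mult_pos_pos)
  then have "(eccentricity d Q)\<^sup>2 < 1\<^sup>2" using eq by simp
  then show "eccentricity d Q < 1" by (rule power2_less_imp_less) simp
qed

text \<open>In \<open>e\<^sup>2 + 2 * e * s = 1\<close> both terms grow with \<open>e\<close> and
  the second with \<open>s\<close>, so \<open>e\<close> falls as \<open>s\<close> rises. Allowing
  two different foci permits a later comparison with a model ellipsoid of focal distance 1.\<close>

lemma eccentricity_le_iff:
  assumes "Q \<noteq> 0" "d > 0" "R \<noteq> 0" "b > 0"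
  shows "eccentricity d Q \<le> eccentricity b R \<longleftrightarrow> b / norm R \<le> d / norm Q"
proof -
  define e where "e = eccentricity d Q"
  define u where "u = eccentricity b R"
  define s where "s = d / norm Q"
  define t where "t = b / norm R"
  have E: "e\<^sup>2 + 2 * e * s = 1" "e > 0" "s > 0"
    using eccentricity_equation[OF assms(1,2)] assms by (simp_all add: e_def s_def)
  have U: "u\<^sup>2 + 2 * u * t = 1" "u > 0" "t > 0"
    using eccentricity_equation[OF assms(3,4)] assms by (simp_all add: u_def t_def)
  have "t \<le> s" if "e \<le> u"
  proof (rule ccontr)
    assume "\<not> t \<le> s"
    then have "e * s < u * t" using that E U by (intro mult_le_less_imp_less) auto
    moreover have "e\<^sup>2 \<le> u\<^sup>2" using that E by (simp add: power_mono)
    ultimately show False using E(1) U(1) by (simp add: mult.assoc)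
  qed
  moreover have "e \<le> u" if "t \<le> s"
  proof (rule ccontr)
    assume "\<not> e \<le> u"
    then have "u * t < e * s" using that E U by (intro mult_less_le_imp_less) auto
    moreover have "u\<^sup>2 \<le> e\<^sup>2" using \<open>\<not> e \<le> u\<close> U by (simp add: power_mono)
    ultimately show False using E(1) U(1) by (simp add: mult.assoc)
  qed
  ultimately show ?thesis unfolding e_def u_def s_def t_def by blast
qed

lemma abs_inner_sgn_le: "norm x = 1 \<Longrightarrow> \<bar>x \<bullet> sgn Q\<bar> \<le> 1"
  using Cauchy_Schwarz_ineq2[of x "sgn Q"] by (simp add: norm_sgn split: if_splits)

lemma polar_denominator_bounds:
  assumes "Q \<noteq> 0" "d > 0" "norm x = 1"
  shows "1 - eccentricity d Q \<le> 1 - eccentricity d Q * (x \<bullet> sgn Q)"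
    "1 - eccentricity d Q * (x \<bullet> sgn Q) \<le> 2"
    "0 < 1 - eccentricity d Q * (x \<bullet> sgn Q)"
proof -
  note e = eccentricity_equation[OF assms(1,2)]
  have "\<bar>eccentricity d Q * (x \<bullet> sgn Q)\<bar> \<le> eccentricity d Q"
    using e abs_inner_sgn_le[OF assms(3), of Q] by (simp add: abs_mult mult_left_le)
  then show "1 - eccentricity d Q \<le> 1 - eccentricity d Q * (x \<bullet> sgn Q)"
    "1 - eccentricity d Q * (x \<bullet> sgn Q) \<le> 2"
    "0 < 1 - eccentricity d Q * (x \<bullet> sgn Q)" using e by linarith+
qed

lemma polar_radius_pos:
  assumes "Q \<noteq> 0" "d > 0" "norm x = 1"
  shows "polar_radius d Q x > 0"
  using polar_denominator_bounds[OF assms] assms by (simp add: polar_radius_def)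

text \<open>Raising the parameter lowers the eccentricity, and towards the focus this works against
  the growth of the radius. After clearing denominators the claim is affine in \<open>s\<close>,
  with slope of a fixed sign because \<open>d * u < b * e\<close>, so the worst direction is
  \<open>s = 1\<close>. There, expressing \<open>d\<close> and \<open>b\<close> through the
  eccentricities gives an explicit positive product.\<close>

lemma polar_radius_strict_mono:
  assumes "Q \<noteq> 0" "norm x = 1" "0 < d" "d < b"
  shows "polar_radius d Q x < polar_radius b Q x"
proof -
  define p where "p = norm Q"
  define e where "e = eccentricity d Q"
  define u where "u = eccentricity b Q"
  define s where "s = x \<bullet> sgn Q"
  have p: "p > 0" using assms by (simp add: p_def)
  have E: "e\<^sup>2 + 2 * e * (d / p) = 1" "0 < e" "e < 1"
    using eccentricity_equation[of Q d] assms by (simp_all add: e_def p_def)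
  have U: "u\<^sup>2 + 2 * u * (b / p) = 1" "0 < u" "u < 1"
    using eccentricity_equation[of Q b] assms by (simp_all add: u_def p_def)
  have ue: "u < e"
    using eccentricity_le_iff[of Q d Q b] assms p
    by (simp add: u_def e_def p_def not_le[symmetric] divide_le_cancel)
  have d: "d = p * (1 - e\<^sup>2) / (2 * e)" and b: "b = p * (1 - u\<^sup>2) / (2 * u)"
    using E U p by (simp_all add: field_simps)
  have "b * (1 - e) - d * (1 - u) = p * (1 - e) * (1 - u) * (e - u) / (2 * e * u)"
    unfolding d b using E U p by (simp add: field_simps power2_eq_square)
  also have "\<dots> > 0" using E U p ue by simp
  finally have *: "b * e - d * u < b - d" by (simp add: algebra_simps)
  have "d * u < b * e" using assms ue U by (intro mult_strict_mono) auto
  then have "s * (b * e - d * u) \<le> b * e - d * u"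
    using abs_inner_sgn_le[OF assms(2), of Q] by (simp add: s_def mult_right_le_one_le)
  with * have "d * (1 - u * s) < b * (1 - e * s)" by (simp add: algebra_simps)
  moreover have "1 - u * s > 0" "1 - e * s > 0"
    using polar_denominator_bounds[of Q d x] polar_denominator_bounds[of Q b x] assms
    by (simp_all add: u_def e_def s_def)
  ultimately show ?thesis
    unfolding polar_radius_def e_def[symmetric] u_def[symmetric] s_def[symmetric]
    by (simp add: field_simps)
qed

lemma polar_radius_less_iff:
  assumes "Q \<noteq> 0" "norm x = 1" "0 < d" "0 < b"
  shows "polar_radius d Q x < polar_radius b Q x \<longleftrightarrow> d < b"
  using polar_radius_strict_mono[OF assms(1,2)] assms(3,4) by (metis less_asym' not_less_iff_gr_or_eq)

lemma polar_radius_le_iff: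
  assumes "Q \<noteq> 0" "norm x = 1" "0 < d" "0 < b"
  shows "polar_radius d Q x \<le> polar_radius b Q x \<longleftrightarrow> d \<le> b"
  using polar_radius_less_iff[OF assms(1,2,4,3)] by (simp add: not_less[symmetric])

section \<open>Null and non-null sets of directions\<close>

text \<open>For \<open>a > 0\<close> the set lies on the frontier of the solid convex cone
  \<open>?K\<close>, and frontiers of convex sets are negligible. Negating \<open>v\<close> reduces
  \<open>a < 0\<close> to this, and \<open>a = 0\<close> is a hyperplane.\<close>

lemma negligible_cone:
  fixes v :: "real^3"
  assumes "v \<noteq> 0 \<or> a \<noteq> 0"
  shows "negligible {y. y \<bullet> v = a * norm y}"
proof -
  have pos: "negligible {y::real^3. y \<bullet> v = a * norm y}" if "a > 0" for a and v :: "real^3"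
  proof -
    let ?K = "{y. a * norm y \<le> y \<bullet> v}"
    have "2 \<le> DIM(real^3)" by simp
    then obtain w where w: "w \<noteq> 0" "orthogonal v w"
      using orthogonal_to_vector_exists[of v] by blast
    have "convex ?K"
    proof (rule convexI)
      fix x y u t :: _ assume xy: "x \<in> ?K" "y \<in> ?K" and ut: "0 \<le> (u::real)" "0 \<le> t" "u + t = 1"
      have "a * norm (u *\<^sub>R x + t *\<^sub>R y) \<le> a * (u * norm x + t * norm y)"
        using that ut by (intro mult_left_mono) (auto intro: order_trans[OF norm_triangle_ineq])
      also have "\<dots> = u * (a * norm x) + t * (a * norm y)" by (simp add: algebra_simps)
      also have "\<dots> \<le> u * (x \<bullet> v) + t * (y \<bullet> v)" using xy ut by (intro add_mono mult_left_mono) auto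
      finally show "u *\<^sub>R x + t *\<^sub>R y \<in> ?K" by (simp add: inner_add_left)
    qed
    then have "negligible (frontier ?K)" by (rule negligible_convex_frontier)
    moreover have "{y. y \<bullet> v = a * norm y} \<subseteq> frontier ?K"
    proof
      fix y assume y: "y \<in> {y. y \<bullet> v = a * norm y}"
      \<comment> \<open>A direction orthogonal to \<open>v\<close> that makes no obtuse angle with
        \<open>y\<close>: moving along it keeps the inner product with \<open>v\<close> and
        increases the norm, so it leaves \<open>?K\<close> at once.\<close>
      define z where "z = (if y \<bullet> w \<ge> 0 then w else - w)"
      have z: "z \<noteq> 0" "z \<bullet> v = 0" "y \<bullet> z \<ge> 0"
        using w by (auto simp: z_def orthogonal_def inner_commute)
      have out: "y + t *\<^sub>R z \<notin> ?K" if "t > 0" for t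
      proof -
        have "(norm y)\<^sup>2 < (norm (y + t *\<^sub>R z))\<^sup>2"
        proof -
          have "0 \<le> t * (y \<bullet> z)" "0 < t * (t * (z \<bullet> z))" using z \<open>t > 0\<close> by simp_all
          then show ?thesis unfolding power2_norm_eq_inner
            by (simp add: inner_add_left inner_add_right inner_commute)
        qed
        then have "norm y < norm (y + t *\<^sub>R z)" by (rule power2_less_imp_less) simp
        then show ?thesis using y z \<open>a > 0\<close> by (simp add: inner_add_left)
      qed
      have "y \<notin> interior ?K"
      proof
        assume "y \<in> interior ?K"
        then obtain e where e: "e > 0" "ball y e \<subseteq> ?K" by (auto simp: mem_interior)
        have "y + (e / (2 * norm z)) *\<^sub>R z \<in> ball y e" using e z by (simp add: dist_norm)
        then show False using out[of "e / (2 * norm z)"] e z by auto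
      qed
      moreover have "y \<in> closure ?K" using y closure_subset[of ?K] by auto
      ultimately show "y \<in> frontier ?K" by (simp add: frontier_def)
    qed
    ultimately show ?thesis by (rule negligible_subset)
  qed
  consider "a > 0" | "a < 0" | "a = 0" by linarith
  then show ?thesis
  proof cases
    case 2
    then have "{y. y \<bullet> v = a * norm y} = {y. y \<bullet> (- v) = (- a) * norm y}" by auto
    with 2 show ?thesis using pos[of "- a" "- v"] by simp
  next
    case 3
    with assms show ?thesis using negligible_hyperplane[of v 0] by (simp add: inner_commute)
  qed (use pos in auto)
qed

lemma space_sphere_measure [simp]: "space sphere_measure = S2"
  by (simp add: sphere_measure_def space_scale_measure space_restrict_space)

lemma sets_sphere_measure_borel: "A \<in> sets (restrict_space borel S2) \<Longrightarrow> A \<in> sets sphere_measure"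
  unfolding sphere_measure_def by (auto intro!: sets_completionI_sets)

lemma borel_measurable_sphere_measure:
  fixes h :: "real^3 \<Rightarrow> real"
  assumes "h \<in> borel_measurable borel"
  shows "h \<in> borel_measurable sphere_measure"
  unfolding sphere_measure_def
  using measurable_restrict_space1[OF assms, of S2] by (intro measurable_completion) simp

lemma null_sets_sphere_measure_circle:
  fixes v :: "real^3"
  assumes "v \<noteq> 0 \<or> a \<noteq> 0"
  shows "{x \<in> S2. x \<bullet> v = a} \<in> null_sets sphere_measure"
proof -
  have cl: "closed {x \<in> S2. x \<bullet> v = a}"
  proof -
    have "closed (S2 \<inter> {x. v \<bullet> x = a})" by (intro closed_Int closed_hyperplane) auto
    then show ?thesis by (simp add: Collect_conj_eq[symmetric] inner_commute Int_def)
  qed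
  then have b: "{x \<in> S2. x \<bullet> v = a} \<in> sets (restrict_space borel S2)"
    by (subst sets_restrict_space_iff) auto
  have sub: "{y. norm y \<le> 1 \<and> y \<noteq> 0 \<and> sgn y \<in> {x \<in> S2. x \<bullet> v = a}} \<subseteq> {y. y \<bullet> v = a * norm y}"
    by (auto simp: sgn_div_norm field_simps)
  have c: "closed {y. y \<bullet> v = a * norm y}"
    by (intro closed_Collect_eq continuous_intros)
  then have "{y. y \<bullet> v = a * norm y} \<in> null_sets lborel"
    using negligible_cone[OF assms] by (simp add: negligible_iff_null_sets null_sets_completion_iff)
  then have "emeasure lborel {y. y \<bullet> v = a * norm y} = 0" by auto
  then have "emeasure lborel {y. norm y \<le> 1 \<and> y \<noteq> 0 \<and> sgn y \<in> {x \<in> S2. x \<bullet> v = a}} = 0"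
    using emeasure_mono[OF sub, of lborel] c by simp
  then show ?thesis
    using b emeasure_sphere_measure[OF b] sets_sphere_measure_borel[OF b] by auto
qed

text \<open>The cone over a nonempty relatively open set of directions contains the nonempty open
  set \<open>?V\<close>, which has positive volume.\<close>

lemma open_not_null_sets_sphere_measure:
  assumes "open U" "U \<inter> S2 \<noteq> {}" "U \<inter> S2 \<subseteq> A" 
  shows "A \<notin> null_sets sphere_measure"
proof
  assume A: "A \<in> null_sets sphere_measure"
  have b: "U \<inter> S2 \<in> sets (restrict_space borel S2)"
    using assms(1) by (subst sets_restrict_space_iff) auto
  have "U \<inter> S2 \<in> null_sets sphere_measure"
    using null_sets_subset[OF A sets_sphere_measure_borel[OF b] assms(3)] .
  then have "emeasure lborel {y. norm y \<le> 1 \<and> y \<noteq> 0 \<and> sgn y \<in> U \<inter> S2} = 0"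
    using emeasure_sphere_measure[OF b] by auto
  moreover have meas: "{y. norm y \<le> 1 \<and> y \<noteq> 0 \<and> sgn y \<in> U \<inter> S2} \<in> sets lborel"
  proof -
    have "(\<lambda>y::real^3. y /\<^sub>R norm y) \<in> borel_measurable borel" by measurable
    then have "sgn \<in> borel_measurable (borel :: (real^3) measure)" unfolding sgn_div_norm by simp
    then have "sgn -` (U \<inter> S2) \<inter> space borel \<in> sets (borel :: (real^3) measure)"
      by (rule measurable_sets) (use assms(1) in auto)
    then have "(cball 0 1 - {0}) \<inter> (sgn -` (U \<inter> S2)) \<in> sets (borel :: (real^3) measure)" by auto
    also have "(cball 0 1 - {0}) \<inter> (sgn -` (U \<inter> S2)) = {y. norm y \<le> 1 \<and> y \<noteq> 0 \<and> sgn y \<in> U \<inter> S2}"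
      by auto
    finally show ?thesis by simp
  qed
  moreover have "open {y::real^3 \<in> ball 0 1 - {0}. sgn y \<in> U}" (is "open ?V")
  proof -
    have "continuous_on (ball 0 1 - {0}) (sgn :: real^3 \<Rightarrow> _)"
      by (intro continuous_intros) auto
    then have "open ((ball 0 1 - {0}) \<inter> sgn -` U)"
      using assms(1) by (intro continuous_open_preimage) auto
    then show ?thesis by (simp add: Int_def vimage_def)
  qed
  moreover have "?V \<noteq> {}"
  proof -
    obtain x where "x \<in> U" "norm x = 1" using assms by auto
    then have "(1/2) *\<^sub>R x \<in> ?V" by (auto simp: sgn_div_norm)
    then show ?thesis by blast
  qed
  moreover have "?V \<subseteq> {y. norm y \<le> 1 \<and> y \<noteq> 0 \<and> sgn y \<in> U \<inter> S2}" by (auto simp: norm_sgn)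
  ultimately have "emeasure lborel ?V = 0" 
    by (metis (lifting) emeasure_mono le_zero_eq)
  then have "negligible ?V" using \<open>open ?V\<close>
    by (metis (lifting) borel_open negligible_iff_null_sets null_setsI null_sets_completionI sets_lborel)
  then show False using \<open>open ?V\<close> \<open>?V \<noteq> {}\<close> open_not_negligible by blast
qed

text \<open>Clearing denominators makes the coincidence a linear equation in \<open>x\<close>, with
  normal vector \<open>v\<close> and right-hand side \<open>b - d\<close>. It degenerates only if
  \<open>b = d\<close> and the eccentricity vectors agree; then directions, eccentricities and hence
  focal distances agree, contradicting \<open>Q \<noteq> R\<close>.\<close>

lemma polar_radius_coincidence_null:
  assumes "Q \<noteq> 0" "R \<noteq> 0" "Q \<noteq> R" "d > 0" "b > 0"
  shows "{x \<in> S2. polar_radius d Q x = polar_radius b R x} \<in> null_sets sphere_measure"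
proof -
  define e where "e = eccentricity d Q"
  define u where "u = eccentricity b R"
  define v where "v = (b * e) *\<^sub>R sgn Q - (d * u) *\<^sub>R sgn R"
  have eu: "e > 0" "u > 0"
    using eccentricity_equation[of Q d] eccentricity_equation[of R b] assms by (auto simp: e_def u_def)
  have ne: "v \<noteq> 0 \<or> b - d \<noteq> 0"
  proof (rule ccontr)
    assume "\<not> ?thesis"
    then have bd: "b = d" and "d *\<^sub>R (e *\<^sub>R sgn Q) = d *\<^sub>R (u *\<^sub>R sgn R)" by (auto simp: v_def)
    then have *: "e *\<^sub>R sgn Q = u *\<^sub>R sgn R" using assms(4) by (metis real_vector.scale_left_imp_eq less_irrefl)
    then have "norm (e *\<^sub>R sgn Q) = norm (u *\<^sub>R sgn R)" by simp
    then have "e = u" using eu assms by (simp add: norm_sgn)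
    then have "sgn Q = sgn R" using * eu by simp
    have "norm R = norm Q"
      using eccentricity_le_iff[of Q d R b] eccentricity_le_iff[of R b Q d] \<open>e = u\<close> bd assms
      by (simp add: e_def u_def divide_le_cancel frac_le_eq field_simps)
    then show False using \<open>sgn Q = sgn R\<close> assms by (simp add: sgn_div_norm)
  qed
  have "{x \<in> S2. polar_radius d Q x = polar_radius b R x} = {x \<in> S2. x \<bullet> v = b - d}"
  proof (intro Collect_cong conj_cong refl)
    fix x :: "real^3" assume "x \<in> S2"
    then have "1 - e * (x \<bullet> sgn Q) > 0" "1 - u * (x \<bullet> sgn R) > 0"
      using polar_denominator_bounds(3)[of Q d x] polar_denominator_bounds(3)[of R b x] assms
      by (simp_all add: e_def u_def)
    then show "(polar_radius d Q x = polar_radius b R x) = (x \<bullet> v = b - d)"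
      unfolding polar_radius_def e_def[symmetric] u_def[symmetric] v_def
      by (simp add: inner_diff_right frac_eq_eq) (auto simp: algebra_simps)
  qed
  then show ?thesis using null_sets_sphere_measure_circle[OF ne] by simp
qed

section \<open>The normal of a surface that is locally an ellipsoid\<close>

text \<open>Existence and uniqueness are both required, because \<open>reflector_normal\<close> is a
  definite description. Agreement with the ellipsoid is assumed only for directions near
  \<open>x\<close>, which is all that a reflector offers.\<close>

lemma is_outer_unit_normal_polar_iff:
  fixes r :: "real^3 \<Rightarrow> real"
  assumes Q: "Q \<noteq> 0" and d: "d > 0" and x: "norm x = 1"
    and K: "K \<subseteq> S2" and r_pos: "\<And>z. z \<in> K \<Longrightarrow> r z > 0"
    and ev: "eventually (\<lambda>z. z \<in> S2 \<longrightarrow> z \<in> K \<and> r z = polar_radius d Q z) (nhds x)"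
  shows "is_outer_unit_normal ((\<lambda>z. r z *\<^sub>R z) ` K) (r x *\<^sub>R x) \<nu>
    \<longleftrightarrow> \<nu> = sgn (x - eccentricity d Q *\<^sub>R sgn Q)"
proof -
  define S where "S = (\<lambda>z. r z *\<^sub>R z) ` K"
  define e where "e = eccentricity d Q"
  define p where "p = r x *\<^sub>R x"
  define n where "n = x - e *\<^sub>R sgn Q"
  \<comment> \<open>This function is positively homogeneous of degree one, and its level set at
    \<open>d\<close> is the ellipsoid. Its gradient at \<open>p\<close> is \<open>n\<close>.\<close>
  define \<phi> where "\<phi> y = norm y - e * (y \<bullet> sgn Q)" for y
  have "x \<in> K" "r x = polar_radius d Q x" using eventually_nhds_x_imp_x[OF ev] x by auto
  then have rx: "r x > 0" "r x = d / (1 - e * (x \<bullet> sgn Q))"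
    using r_pos[of x] by (simp_all add: polar_radius_def e_def)
  have den: "1 - e * (z \<bullet> sgn Q) > 0" if "norm z = 1" for z
    using polar_denominator_bounds(3)[OF Q d that] by (simp add: e_def)
  have xx: "x \<bullet> x = 1" using x by (simp add: norm_eq_1)
  have xn: "x \<bullet> n = 1 - e * (x \<bullet> sgn Q)" by (simp add: n_def inner_diff_right xx)
  have pn: "p \<bullet> n = d" using rx den[OF x] xn by (simp add: p_def)
  then have n0: "n \<noteq> 0" using d by auto
  have p0: "p \<noteq> 0" and sgn_p: "sgn p = x" and norm_p: "norm p = r x"
    using rx(1) x by (auto simp: p_def sgn_scaleR sgn_div_norm)
  have \<phi>_pos: "\<phi> (t *\<^sub>R z) = t * (1 - e * (z \<bullet> sgn Q))" if "t \<ge> 0" "norm z = 1" for t z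
    using that by (simp add: \<phi>_def algebra_simps)
  have \<phi>_p: "\<phi> p = d" using rx den[OF x] \<phi>_pos[of "r x" x] x by (simp add: p_def)
  have D\<phi>: "(\<phi> has_derivative (\<lambda>h. h \<bullet> n)) (at p within T)" for T
  proof -
    have "(norm has_derivative (\<lambda>h. h \<bullet> x)) (at p within T)"
      using has_derivative_norm[OF p0] sgn_p by (simp add: has_derivative_at_withinI)
    then have "((\<lambda>y. norm y - e * (y \<bullet> sgn Q)) has_derivative (\<lambda>h. h \<bullet> x - e * (h \<bullet> sgn Q))) (at p within T)"
      by (auto intro!: derivative_eq_intros)
    then show ?thesis by (simp add: \<phi>_def[abs_def] n_def inner_diff_right)
  qed
  have normal: "is_outer_unit_normal S p (sgn n)"
    unfolding is_outer_unit_normal_def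
  proof (intro conjI)
    show "norm (sgn n) = 1" using n0 by (simp add: norm_sgn)
    show "0 < p \<bullet> sgn n" using n0 pn d by (simp add: sgn_div_norm)
    have "eventually (\<lambda>y. y \<in> S) (at p within S)" by (simp add: eventually_at_filter)
    moreover have "(sgn \<longlongrightarrow> x) (at p within S)"
      using tendsto_sgn[OF tendsto_ident_at p0, of S] sgn_p by simp
    then have "eventually (\<lambda>y. sgn y \<in> S2 \<longrightarrow> sgn y \<in> K \<and> r (sgn y) = polar_radius d Q (sgn y)) (at p within S)"
      using ev by (rule eventually_compose_filterlim[rotated])
    ultimately have "eventually (\<lambda>y. norm (\<phi> y - \<phi> p - (y - p) \<bullet> n) / norm (y - p)
        = norm ((y - p) \<bullet> n) / norm (y - p)) (at p within S)"
    proof eventually_elim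
      case (elim y)
      then obtain z where z: "z \<in> K" "y = r z *\<^sub>R z" by (auto simp: S_def)
      then have z1: "norm z = 1" and rz: "r z > 0" using K r_pos by auto
      then have "sgn y = z" using z by (simp add: sgn_scaleR sgn_div_norm)
      then have "r z = d / (1 - e * (z \<bullet> sgn Q))"
        using elim z1 by (auto simp: polar_radius_def e_def)
      then have "\<phi> y = d" using \<phi>_pos[of "r z" z] rz z1 den[OF z1] z by simp
      then show ?case by (simp add: \<phi>_p)
    qed
    moreover have "((\<lambda>y. norm (\<phi> y - \<phi> p - (y - p) \<bullet> n) / norm (y - p)) \<longlongrightarrow> 0) (at p within S)"
      using D\<phi>[of S] by (simp add: has_derivative_iff_norm)
    ultimately have "((\<lambda>y. norm ((y - p) \<bullet> n) / norm (y - p)) \<longlongrightarrow> 0) (at p within S)"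
      by (rule Lim_transform_eventually[rotated])
    then have "((\<lambda>y. norm (((y - p) \<bullet> n) / norm (y - p))) \<longlongrightarrow> 0) (at p within S)" by simp
    then have "((\<lambda>y. ((y - p) \<bullet> n) / norm (y - p)) \<longlongrightarrow> 0) (at p within S)"
      by (rule tendsto_norm_zero_cancel)
    then have "((\<lambda>y. (((y - p) \<bullet> n) / norm (y - p)) * inverse (norm n)) \<longlongrightarrow> 0 * inverse (norm n)) (at p within S)"
      by (intro tendsto_mult tendsto_const)
    then show "((\<lambda>y. ((y - p) \<bullet> sgn n) / norm (y - p)) \<longlongrightarrow> 0) (at p within S)"
      by (simp add: sgn_div_norm field_simps)
  qed
  have unique: "\<nu> = sgn n" if \<nu>: "is_outer_unit_normal S p \<nu>"
  proof -
    \<comment> \<open>Splits \<nu> into a multiple of \<open>n\<close> and a tangential part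
      \<open>v\<close>; uniqueness amounts to \<open>v = 0\<close>.\<close>
    define a where "a = (\<nu> \<bullet> n) / (n \<bullet> n)"
    define v where "v = \<nu> - a *\<^sub>R n"
    have nn: "n \<bullet> n > 0" using n0 by simp
    have vn: "v \<bullet> n = 0" using nn by (simp add: v_def a_def inner_diff_left)
    have "v = 0"
    proof (rule ccontr)
      assume v0: "v \<noteq> 0"
      define q where "q s = p + s *\<^sub>R v" for s :: real
      \<comment> \<open>The tangent line \<open>q\<close> is rescaled radially back to the level
        \<open>d\<close>, which homogeneity allows. As \<open>\<phi> \<circ> q\<close> is stationary
        at 0, the resulting curve on the surface still has velocity \<open>v\<close>.\<close>
      define y where "y s = (d / \<phi> (q s)) *\<^sub>R q s" for s
      have y0: "y 0 = p" using d by (simp add: y_def q_def \<phi>_p)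
      have "(q has_vector_derivative v) (at 0)"
        unfolding q_def[abs_def] by (auto intro!: derivative_eq_intros)
      then have Dq: "(q has_derivative (\<lambda>h. h *\<^sub>R v)) (at 0)" by (simp add: has_vector_derivative_def)
      have "((\<phi> \<circ> q) has_derivative (\<lambda>h. h \<bullet> n) \<circ> (\<lambda>h. h *\<^sub>R v)) (at 0)"
        using Dq D\<phi>[of UNIV] by (intro diff_chain_at) (simp_all add: q_def)
      then have "((\<lambda>s. \<phi> (q s)) has_field_derivative 0) (at 0)"
        by (simp add: has_field_derivative_def o_def vn flip: lambda_zero)
      then have "((\<lambda>s. d / \<phi> (q s)) has_field_derivative 0) (at 0)"
        using d by (auto intro!: derivative_eq_intros simp: q_def \<phi>_p)
      then have "((\<lambda>s. (d / \<phi> (q s)) *\<^sub>R q s) has_derivative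
          (\<lambda>h. (d / \<phi> (q 0)) *\<^sub>R (h *\<^sub>R v) + (0 * h) *\<^sub>R q 0)) (at 0)"
        unfolding has_field_derivative_def by (rule has_derivative_scaleR) (rule Dq)
      then have "(y has_derivative (\<lambda>h. h *\<^sub>R v)) (at 0)"
        using d by (simp add: y_def[abs_def] q_def \<phi>_p)
      then have "(y has_derivative (\<lambda>h. h *\<^sub>R v)) (at_right 0)"
        by (rule has_derivative_at_withinI)
      then have "((\<lambda>s. (1 / norm s) *\<^sub>R (y s - (p + s *\<^sub>R v))) \<longlongrightarrow> 0) (at_right 0)"
        by (simp add: has_derivative_within y0)
      then have "((\<lambda>s. (1 / norm s) *\<^sub>R (y s - (p + s *\<^sub>R v)) + v) \<longlongrightarrow> 0 + v) (at_right 0)"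
        by (intro tendsto_add tendsto_const)
      moreover have ev_pos: "eventually (\<lambda>s. s > 0) (at_right (0::real))"
        by (simp add: eventually_at_right_less)
      then have "eventually (\<lambda>s. (1 / norm s) *\<^sub>R (y s - (p + s *\<^sub>R v)) + v = (y s - p) /\<^sub>R s) (at_right 0)"
        by eventually_elim (simp add: algebra_simps inverse_eq_divide)
      ultimately have lim: "((\<lambda>s. (y s - p) /\<^sub>R s) \<longlongrightarrow> v) (at_right 0)"
        using Lim_transform_eventually by fastforce
      \<comment> \<open>The limit defining the normal ignores \<open>p\<close> itself, so the curve
        must really leave \<open>p\<close>; its nonzero velocity guarantees this.\<close>
      have "eventually (\<lambda>s. (y s - p) /\<^sub>R s \<noteq> 0) (at_right 0)"
        using lim v0 by (rule tendsto_imp_eventually_ne)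
      then have ne: "eventually (\<lambda>s. y s \<noteq> p) (at_right 0)"
        by eventually_elim auto
      have qlim: "(q \<longlongrightarrow> p) (at_right 0)"
        unfolding q_def by (auto intro!: tendsto_eq_intros)
      have "((\<lambda>s. sgn (q s)) \<longlongrightarrow> x) (at_right 0)" using tendsto_sgn[OF qlim p0] sgn_p by simp
      then have evq: "eventually (\<lambda>s. sgn (q s) \<in> S2 \<longrightarrow> sgn (q s) \<in> K \<and>
          r (sgn (q s)) = polar_radius d Q (sgn (q s))) (at_right 0)"
        using ev by (rule eventually_compose_filterlim[rotated])
      have "eventually (\<lambda>s. q s \<noteq> 0) (at_right 0)" using qlim p0 by (rule tendsto_imp_eventually_ne)
      with evq have inS: "eventually (\<lambda>s. y s \<in> S) (at_right 0)"
      proof eventually_elim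
        case (elim s)
        define z where "z = sgn (q s)"
        have z1: "norm z = 1" using elim by (simp add: z_def norm_sgn)
        have qz: "q s = norm (q s) *\<^sub>R z" using elim by (simp add: z_def sgn_div_norm)
        have "\<phi> (q s) = norm (q s) * (1 - e * (z \<bullet> sgn Q))"
          using \<phi>_pos[of "norm (q s)" z] qz z1 by simp
        then have "(d / \<phi> (q s)) * norm (q s) = polar_radius d Q z"
          using elim by (simp add: polar_radius_def e_def)
        then have "y s = polar_radius d Q z *\<^sub>R z"
          unfolding y_def by (subst (2) qz) simp
        moreover have "z \<in> K" "r z = polar_radius d Q z" using elim z1 by (auto simp: z_def)
        ultimately show ?case unfolding S_def by (intro image_eqI[of _ _ z]) simp_all
      qed
      have "isCont y 0" using \<open>(y has_derivative (\<lambda>h. h *\<^sub>R v)) (at 0)\<close>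
        by (rule has_derivative_continuous)
      then have "(y \<longlongrightarrow> p) (at 0)" by (simp add: isCont_def y0)
      then have "(y \<longlongrightarrow> p) (at_right 0)" by (rule tendsto_mono[OF at_le, rotated]) simp
      then have "filterlim y (at p within S) (at_right 0)"
        using inS ne by (auto simp: filterlim_at eventually_conj)
      moreover have "((\<lambda>y. ((y - p) \<bullet> \<nu>) / norm (y - p)) \<longlongrightarrow> 0) (at p within S)"
        using \<nu> by (simp add: is_outer_unit_normal_def)
      ultimately have "((\<lambda>s. ((y s - p) \<bullet> \<nu>) / norm (y s - p)) \<longlongrightarrow> 0) (at_right 0)"
        by (rule filterlim_compose[rotated])
      \<comment> \<open>Multiplying by the bounded difference quotient turns the angle condition
        into \<open>v \<bullet> \<nu> = 0\<close>. Since \<open>v\<close> is orthogonal to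
        \<open>n\<close>, this inner product equals \<open>v \<bullet> v\<close>.\<close>
      then have "((\<lambda>s. ((y s - p) \<bullet> \<nu>) / norm (y s - p) * norm ((y s - p) /\<^sub>R s)) \<longlongrightarrow> 0 * norm v) (at_right 0)"
        by (intro tendsto_mult tendsto_norm lim)
      moreover have "eventually (\<lambda>s. ((y s - p) \<bullet> \<nu>) / norm (y s - p) * norm ((y s - p) /\<^sub>R s)
          = ((y s - p) /\<^sub>R s) \<bullet> \<nu>) (at_right 0)"
        using ev_pos ne by eventually_elim simp
      ultimately have "((\<lambda>s. ((y s - p) /\<^sub>R s) \<bullet> \<nu>) \<longlongrightarrow> 0) (at_right 0)"
        using Lim_transform_eventually by fastforce
      moreover have "((\<lambda>s. ((y s - p) /\<^sub>R s) \<bullet> \<nu>) \<longlongrightarrow> v \<bullet> \<nu>) (at_right 0)"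
        by (intro tendsto_inner lim tendsto_const)
      ultimately have "v \<bullet> \<nu> = 0" using tendsto_unique trivial_limit_at_right_real by blast
      moreover have "v \<bullet> v = v \<bullet> \<nu>" using vn by (subst (2) v_def) (simp add: inner_diff_right)
      ultimately show False using v0 by simp
    qed
    then have \<nu>a: "\<nu> = a *\<^sub>R n" by (simp add: v_def)
    moreover have "a > 0"
      using \<nu> pn d by (auto simp: is_outer_unit_normal_def \<nu>a zero_less_mult_iff)
    ultimately have "sgn \<nu> = sgn n" by (simp add: sgn_scaleR)
    moreover have "sgn \<nu> = \<nu>" using \<nu> by (simp add: is_outer_unit_normal_def sgn_div_norm)
    ultimately show ?thesis by simp
  qed
  show ?thesis using normal unique unfolding S_def p_def n_def e_def by blast
qed

section \<open>The energy factor of one ellipsoid: bounds, continuity, measurability\<close>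

text \<open>The factor multiplying \<open>f\<close> in the reflector measure wherever this ellipsoid
  is the active one, with its normal in closed form.\<close>

definition ellipsoid_weight :: "real \<Rightarrow> real^3 \<Rightarrow> real^3 \<Rightarrow> real" where
  "ellipsoid_weight d Q x =
     (x \<bullet> sgn (x - eccentricity d Q *\<^sub>R sgn Q)) / (polar_radius d Q x)\<^sup>2"

text \<open>The unnormalised normal \<open>n\<close> has \<open>x \<bullet> n\<close> at least
  \<open>1 - e\<close> and length at most \<open>1 + e\<close>. The quotient is the origin of one
  factor of the constant \<open>C\<close> in the theorem.\<close>

lemma inner_ellipsoid_normal_bounds:
  assumes "Q \<noteq> 0" "d > 0" "norm x = 1"
  shows "(1 - eccentricity d Q) / (1 + eccentricity d Q) \<le> x \<bullet> sgn (x - eccentricity d Q *\<^sub>R sgn Q)"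
    "0 < x \<bullet> sgn (x - eccentricity d Q *\<^sub>R sgn Q)"
    "x \<bullet> sgn (x - eccentricity d Q *\<^sub>R sgn Q) \<le> 1"
proof -
  define e where "e = eccentricity d Q"
  define n where "n = x - e *\<^sub>R sgn Q"
  have e: "0 < e" "e < 1" using eccentricity_equation[OF assms(1,2)] by (simp_all add: e_def)
  have xn: "x \<bullet> n = 1 - e * (x \<bullet> sgn Q)" using assms(3) by (simp add: n_def inner_diff_right norm_eq_1)
  have b: "1 - e \<le> x \<bullet> n" "0 < x \<bullet> n"
    using polar_denominator_bounds[OF assms] by (simp_all add: xn e_def)
  then have n0: "0 < norm n" by auto
  have "norm n \<le> norm x + norm (e *\<^sub>R sgn Q)" unfolding n_def by (rule norm_triangle_ineq4)
  then have n1: "norm n \<le> 1 + e" using assms e by (simp add: norm_sgn)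
  have eq: "x \<bullet> sgn n = (x \<bullet> n) / norm n" by (simp add: sgn_div_norm divide_inverse mult.commute)
  show "(1 - e) / (1 + e) \<le> x \<bullet> sgn n" unfolding eq using b n0 n1 e by (intro frac_le) auto
  show "0 < x \<bullet> sgn n" unfolding eq using b n0 by simp
  show "x \<bullet> sgn n \<le> 1" using norm_cauchy_schwarz[of x "sgn n"] assms n0 by (simp add: norm_sgn)
qed

lemma ellipsoid_weight_pos:
  assumes "Q \<noteq> 0" "d > 0" "norm x = 1"
  shows "ellipsoid_weight d Q x > 0"
  using inner_ellipsoid_normal_bounds(2)[OF assms] polar_radius_pos[OF assms]
  by (simp add: ellipsoid_weight_def)

text \<open>The denominator of the polar radius is at most 2, so the radius is at least
  \<open>b / 2\<close>. The bound is uniform over all parameters above \<open>b\<close>, as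
  dominated convergence requires.\<close>

lemma ellipsoid_weight_le:
  assumes "Q \<noteq> 0" "b > 0" "b \<le> d" "norm x = 1"
  shows "ellipsoid_weight d Q x \<le> 4 / b\<^sup>2"
proof -
  have d: "d > 0" using assms by simp
  note den = polar_denominator_bounds[OF assms(1) d assms(4)]
  have "b / 2 \<le> polar_radius d Q x"
    unfolding polar_radius_def using den assms by (intro frac_le) auto
  then have "(b / 2)\<^sup>2 \<le> (polar_radius d Q x)\<^sup>2" using assms by (intro power_mono) auto
  then have "ellipsoid_weight d Q x \<le> 1 / (b / 2)\<^sup>2"
    unfolding ellipsoid_weight_def
    using inner_ellipsoid_normal_bounds[OF assms(1) d assms(4)] assms by (intro frac_le) auto
  then show ?thesis by (simp add: power_divide)
qed

lemma tendsto_eccentricity: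
  assumes "(d \<longlongrightarrow> b) F"
  shows "((\<lambda>n. eccentricity (d n) Q) \<longlongrightarrow> eccentricity b Q) F"
  unfolding eccentricity_def divide_inverse by (intro tendsto_intros assms)

lemma tendsto_polar_radius:
  assumes "(d \<longlongrightarrow> b) F" "Q \<noteq> 0" "b > 0" "norm x = 1"
  shows "((\<lambda>n. polar_radius (d n) Q x) \<longlongrightarrow> polar_radius b Q x) F"
  unfolding polar_radius_def using polar_denominator_bounds(3)[OF assms(2-4)]
  by (intro tendsto_intros tendsto_eccentricity assms) auto

lemma tendsto_ellipsoid_weight:
  assumes "(d \<longlongrightarrow> b) F" "Q \<noteq> 0" "b > 0" "norm x = 1"
  shows "((\<lambda>n. ellipsoid_weight (d n) Q x) \<longlongrightarrow> ellipsoid_weight b Q x) F"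
proof -
  have "x - eccentricity b Q *\<^sub>R sgn Q \<noteq> 0"
    using inner_ellipsoid_normal_bounds(2)[OF assms(2-4)] by auto
  moreover have "(polar_radius b Q x)\<^sup>2 \<noteq> 0" using polar_radius_pos[OF assms(2-4)] by simp
  ultimately show ?thesis unfolding ellipsoid_weight_def
    by (intro tendsto_intros tendsto_eccentricity tendsto_polar_radius assms)
qed

lemma isCont_polar_radius:
  assumes "Q \<noteq> 0" "d > 0" "norm x = 1"
  shows "isCont (polar_radius d Q) x"
  unfolding polar_radius_def[abs_def] using polar_denominator_bounds(3)[OF assms]
  by (intro continuous_intros) auto

lemma polar_radius_measurable [measurable]: "polar_radius d Q \<in> borel_measurable borel"
  unfolding polar_radius_def[abs_def] by measurable

lemma ellipsoid_weight_measurable [measurable]: "ellipsoid_weight d Q \<in> borel_measurable borel"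
  unfolding ellipsoid_weight_def[abs_def] sgn_div_norm[of "_ - _"] by measurable

text \<open>Supplies measurability of the original integrand, which is known only to agree almost
  everywhere with a measurable function.\<close>

lemma (in complete_measure) borel_measurable_AE_cong:
  fixes g h :: "'a \<Rightarrow> real"
  assumes "g \<in> borel_measurable M" "AE x in M. g x = h x"
  shows "h \<in> borel_measurable M"
proof (rule measurableI)
  fix A :: "real set" assume "A \<in> sets borel"
  then have A: "g -` A \<inter> space M \<in> sets M" using assms(1) by (simp add: measurable_sets)
  have ae: "AE x in M. x \<in> g -` A \<inter> space M \<longleftrightarrow> x \<in> h -` A \<inter> space M"
    using assms(2) by eventually_elim simp
  show "h -` A \<inter> space M \<in> sets M" by (rule in_sets_AE[OF ae A]) simp
qed simp

lemma complete_sphere_measure: "complete_measure sphere_measure"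
  unfolding sphere_measure_def by (rule completion.complete_measure_axioms)

section \<open>Cells, and the reflector measure as a sum of cell integrals\<close>

locale point_source_reflector =
  fixes \<Omega> :: "(real^3) set" and f :: "real^3 \<Rightarrow> real" and N :: nat and P :: "nat \<Rightarrow> real^3"
  assumes domain_subset: "\<Omega> \<subseteq> S2"
    and frontier_null: "(top_of_set S2) frontier_of \<Omega> \<in> null_sets sphere_measure"
    and f_integrable: "set_integrable sphere_measure (closure \<Omega>) f"
    and f_pos: "AE x in sphere_measure. x \<in> closure \<Omega> \<longrightarrow> f x > 0"
    and N_pos: "N > 0"
    and inj_P: "inj_on P {1..N}"
    and P_nonzero: "\<And>i. i \<in> {1..N} \<Longrightarrow> P i \<noteq> 0"
begin

abbreviation radius :: "(nat \<Rightarrow> real) \<Rightarrow> nat \<Rightarrow> real^3 \<Rightarrow> real" where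
  "radius w i \<equiv> polar_radius (w i) (P i)"

definition cell :: "(nat \<Rightarrow> real) \<Rightarrow> nat \<Rightarrow> (real^3) set" where
  "cell w i = {x \<in> closure \<Omega>. \<forall>j\<in>{1..N}. radius w i x \<le> radius w j x}"

definition density :: "(nat \<Rightarrow> real) \<Rightarrow> nat \<Rightarrow> real^3 \<Rightarrow> real" where
  "density w i x = (if x \<in> cell w i then f x * ellipsoid_weight (w i) (P i) x else 0)"

text \<open>The first clause surrounds \<open>x\<close> by directions of \<Omega>, so that the
  reflector near \<open>x\<close> is a full surface patch with a determined normal; the second
  excludes ties between ellipsoids.\<close>

definition generic :: "(nat \<Rightarrow> real) \<Rightarrow> real^3 \<Rightarrow> bool" where
  "generic w x \<longleftrightarrow> (\<exists>U. open U \<and> x \<in> U \<and> U \<inter> S2 \<subseteq> \<Omega>) \<and>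
     (\<forall>i\<in>{1..N}. \<forall>j\<in>{1..N}. i \<noteq> j \<longrightarrow> radius w i x \<noteq> radius w j x)"

abbreviation positive :: "(nat \<Rightarrow> real) \<Rightarrow> bool" where
  "positive w \<equiv> \<forall>i\<in>{1..N}. w i > 0"

lemma closure_subset_sphere: "closure \<Omega> \<subseteq> S2"
  using domain_subset by (simp add: closure_minimal)

lemma norm_closure: "x \<in> closure \<Omega> \<Longrightarrow> norm x = 1"
  using closure_subset_sphere by auto

lemma radius_pos: "\<lbrakk>positive w; i \<in> {1..N}; norm x = 1\<rbrakk> \<Longrightarrow> radius w i x > 0"
  by (simp add: polar_radius_pos P_nonzero)

lemma AE_generic:
  assumes "positive w"
  shows "AE x in sphere_measure. x \<in> closure \<Omega> \<longrightarrow> generic w x"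
proof -
  have "AE x in sphere_measure. x \<in> closure \<Omega> \<longrightarrow> (\<exists>U. open U \<and> x \<in> U \<and> U \<inter> S2 \<subseteq> \<Omega>)"
    using AE_not_in[OF frontier_null]
  proof eventually_elim
    case (elim x)
    show ?case
    proof
      assume x: "x \<in> closure \<Omega>"
      then have "x \<in> (top_of_set S2) closure_of \<Omega>"
        using closure_subset_sphere domain_subset
        by (auto simp: closure_of_subtopology Int_absorb1)
      then have "x \<in> (top_of_set S2) interior_of \<Omega>" using elim by (auto simp: frontier_of_def)
      then obtain T where "openin (top_of_set S2) T" "x \<in> T" "T \<subseteq> \<Omega>" by (auto simp: interior_of_def)
      then show "\<exists>U. open U \<and> x \<in> U \<and> U \<inter> S2 \<subseteq> \<Omega>" by (auto simp: openin_open)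
    qed
  qed
  moreover have "AE x in sphere_measure. \<forall>i\<in>{1..N}. \<forall>j\<in>{1..N}. i \<noteq> j \<longrightarrow> radius w i x \<noteq> radius w j x"
  proof (intro AE_finite_allI finite_atLeastAtMost)
    fix i j assume ij: "i \<in> {1..N}" "j \<in> {1..N}"
    show "AE x in sphere_measure. i \<noteq> j \<longrightarrow> radius w i x \<noteq> radius w j x"
    proof (cases "i = j")
      case False
      then have "P i \<noteq> P j" using inj_P ij by (auto dest: inj_onD)
      then have "{x \<in> S2. radius w i x = radius w j x} \<in> null_sets sphere_measure"
        using ij assms by (intro polar_radius_coincidence_null P_nonzero) auto
      from AE_not_in[OF this] AE_space show ?thesis
        by eventually_elim auto
    qed simp
  qed
  ultimately show ?thesis by eventually_elim (simp add: generic_def)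
qed

lemma reflector_radius_cell:
  assumes "x \<in> cell w i" "i \<in> {1..N}"
  shows "reflector_radius N P w x = radius w i x"
  unfolding reflector_radius_def using assms by (intro Min_eqI) (auto simp: cell_def)

lemma reflector_radius_le: "i \<in> {1..N} \<Longrightarrow> reflector_radius N P w x \<le> radius w i x"
  unfolding reflector_radius_def by (intro Min_le) auto

lemma reflector_radius_attained:
  obtains i where "i \<in> {1..N}" "reflector_radius N P w x = radius w i x"
proof -
  have "Min ((\<lambda>i. radius w i x) ` {1..N}) \<in> (\<lambda>i. radius w i x) ` {1..N}"
    using N_pos by (intro Min_in) auto
  then show ?thesis using that unfolding reflector_radius_def by auto
qed

lemma cell_cover:
  assumes "x \<in> closure \<Omega>"
  obtains i where "i \<in> {1..N}" "x \<in> cell w i"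
proof -
  obtain i where i: "i \<in> {1..N}" "reflector_radius N P w x = radius w i x"
    by (rule reflector_radius_attained)
  have "radius w i x \<le> radius w j x" if "j \<in> {1..N}" for j
    using reflector_radius_le[OF that, of w x] i(2) by simp
  then have "x \<in> cell w i" using assms by (simp add: cell_def)
  with i(1) show ?thesis by (rule that)
qed

lemma generic_cell_unique:
  assumes "generic w x" "x \<in> cell w i" "i \<in> {1..N}" "j \<in> {1..N}" "j \<noteq> i"
  shows "radius w i x < radius w j x" "x \<notin> cell w j"
proof -
  have "radius w i x \<noteq> radius w j x" using assms by (auto simp: generic_def)
  moreover have "radius w i x \<le> radius w j x" using assms(2,4) by (simp add: cell_def)
  ultimately show lt: "radius w i x < radius w j x" by simp
  then show "x \<notin> cell w j" using assms(3) by (auto simp: cell_def not_le)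
qed

lemma generic_not_cell:
  assumes "x \<in> closure \<Omega>" "x \<notin> cell w i" "i \<in> {1..N}"
  obtains j where "j \<in> {1..N}" "radius w j x < radius w i x"
  using assms by (auto simp: cell_def not_le)

text \<open>If the i-th ellipsoid is inactive, \<open>P i\<close> may still be the focus of a (unique, smaller)
  supporting ellipsoid; it touches the reflector only where it meets another ellipsoid.\<close>

lemma AE_tracing_map_iff_cell:
  assumes w: "positive w" and i: "i \<in> {1..N}"
  shows "AE x in sphere_measure. x \<in> tracing_map \<Omega> N P w (P i) \<longleftrightarrow> x \<in> cell w i"
proof -
  let ?\<rho> = "reflector_radius N P w"
  have cell_sub: "cell w i \<subseteq> tracing_map \<Omega> N P w (P i)"
  proof
    fix x assume x: "x \<in> cell w i"
    then have "supports \<Omega> N P w (w i) (P i) x"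
      using reflector_radius_le[OF i] reflector_radius_cell[OF x i] by (simp add: supports_def)
    then show "x \<in> tracing_map \<Omega> N P w (P i)"
      using x w i by (auto simp: tracing_map_def cell_def)
  qed
  show ?thesis
  proof (cases "tracing_map \<Omega> N P w (P i) \<subseteq> cell w i")
    case True
    with cell_sub show ?thesis by auto
  next
    case False
    then obtain z where z: "z \<in> tracing_map \<Omega> N P w (P i)" "z \<notin> cell w i" by auto
    then obtain b where b: "b > 0" "supports \<Omega> N P w b (P i) z" and zO: "z \<in> closure \<Omega>"
      by (auto simp: tracing_map_def)
    obtain j where "j \<in> {1..N}" "radius w j z < radius w i z"
      using generic_not_cell[OF zO z(2) i] .
    then have "?\<rho> z < radius w i z" using reflector_radius_le[of j w z] by simp
    \<comment> \<open>So the supporting ellipsoid lies strictly below the i-th one in every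
      direction, and a contact can involve only ellipsoids with index other than
      \<open>i\<close>.\<close>
    then have bw: "b < w i"
      using b polar_radius_less_iff[of "P i" z b "w i"] P_nonzero[OF i] norm_closure[OF zO] w i
      by (simp add: supports_def)
    \<comment> \<open>Two supporting ellipsoids with the same focus are compared at each other's
      contact points. Uniqueness leaves a single \<open>b\<close>, hence finitely many exceptional
      circles instead of a family indexed by a continuum.\<close>
    have unique: "b' = b" if b': "b' > 0" "supports \<Omega> N P w b' (P i) x" and x: "x \<in> closure \<Omega>" for b' x
    proof -
      have "polar_radius b' (P i) x \<le> polar_radius b (P i) x" "polar_radius b (P i) z \<le> polar_radius b' (P i) z"
        using b b' x zO by (auto simp: supports_def)
      then show ?thesis
        using polar_radius_le_iff[of "P i" x b' b] polar_radius_le_iff[of "P i" z b b']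
          b b' P_nonzero[OF i] norm_closure x zO by simp
    qed
    have "AE x in sphere_measure. \<forall>j\<in>{1..N}. j \<noteq> i \<longrightarrow> polar_radius b (P i) x \<noteq> radius w j x"
    proof (intro AE_finite_allI finite_atLeastAtMost)
      fix j assume j: "j \<in> {1..N}"
      show "AE x in sphere_measure. j \<noteq> i \<longrightarrow> polar_radius b (P i) x \<noteq> radius w j x"
      proof (cases "j = i")
        case False
        then have "P i \<noteq> P j" using inj_P i j by (auto dest: inj_onD)
        then have "{x \<in> S2. polar_radius b (P i) x = radius w j x} \<in> null_sets sphere_measure"
          using i j w b by (intro polar_radius_coincidence_null P_nonzero) auto
        from AE_not_in[OF this] AE_space show ?thesis by eventually_elim auto
      qed simp
    qed
    then show ?thesis
    proof eventually_elim
      case (elim x)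
      have "x \<notin> tracing_map \<Omega> N P w (P i)"
      proof
        assume "x \<in> tracing_map \<Omega> N P w (P i)"
        then obtain b' where "x \<in> closure \<Omega>" "b' > 0" "supports \<Omega> N P w b' (P i) x"
          by (auto simp: tracing_map_def)
        then have x: "x \<in> closure \<Omega>" "?\<rho> x = polar_radius b (P i) x"
          using unique[of b' x] by (auto simp: supports_def)
        obtain j where j: "j \<in> {1..N}" "?\<rho> x = radius w j x" by (rule reflector_radius_attained)
        then have "j = i" using elim x by auto
        then show False
          using x j bw b polar_radius_less_iff[of "P i" x b "w i"] P_nonzero[OF i] norm_closure[OF x(1)] by simp
      qed
      then show ?case using cell_sub by auto
    qed
  qed
qed

text \<open>Without ties the inequalities against the other ellipsoids are strict and persist near
  \<open>x\<close> by continuity, so the reflector coincides there with the i-th ellipsoid.\<close>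

lemma reflector_normal_cell:
  assumes w: "positive w" and i: "i \<in> {1..N}" and x: "x \<in> cell w i" "generic w x"
  shows "reflector_normal \<Omega> N P w x = sgn (x - eccentricity (w i) (P i) *\<^sub>R sgn (P i))"
proof -
  let ?\<rho> = "reflector_radius N P w"
  have xO: "x \<in> closure \<Omega>" using x by (simp add: cell_def)
  have nx: "norm x = 1" using norm_closure[OF xO] .
  obtain U where U: "open U" "x \<in> U" "U \<inter> S2 \<subseteq> \<Omega>" using x by (auto simp: generic_def)
  have cont: "(radius w j \<longlongrightarrow> radius w j x) (nhds x)" if "j \<in> {1..N}" for j
    using isCont_polar_radius[of "P j" "w j" x] P_nonzero w nx that
    by (auto simp: isCont_def tendsto_at_iff_tendsto_nhds)
  have "eventually (\<lambda>z. \<forall>j\<in>{1..N}. j \<noteq> i \<longrightarrow> radius w i z < radius w j z) (nhds x)"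
  proof (intro eventually_ball_finite ballI finite_atLeastAtMost)
    fix j assume j: "j \<in> {1..N}"
    show "eventually (\<lambda>z. j \<noteq> i \<longrightarrow> radius w i z < radius w j z) (nhds x)"
    proof (cases "j = i")
      case False
      then have "radius w i x < radius w j x" using generic_cell_unique(1)[OF x(2,1) i j] by simp
      from order_tendstoD[OF tendsto_diff[OF cont[OF j] cont[OF i]], of 0] this
      have "eventually (\<lambda>z. 0 < radius w j z - radius w i z) (nhds x)" by simp
      then show ?thesis by eventually_elim simp
    qed simp
  qed
  moreover have "eventually (\<lambda>z. z \<in> U) (nhds x)" using U by (simp add: eventually_nhds_in_open)
  ultimately have "eventually (\<lambda>z. z \<in> S2 \<longrightarrow> z \<in> closure \<Omega> \<and> ?\<rho> z = radius w i z) (nhds x)"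
  proof eventually_elim
    case (elim z)
    show ?case
    proof
      assume "z \<in> S2"
      then have zO: "z \<in> closure \<Omega>" using elim U closure_subset[of \<Omega>] by auto
      moreover have "radius w i z \<le> radius w j z" if "j \<in> {1..N}" for j
        using elim(1) that by (cases "j = i") (auto intro: less_imp_le)
      then have "z \<in> cell w i" using zO by (simp add: cell_def)
      ultimately show "z \<in> closure \<Omega> \<and> ?\<rho> z = radius w i z"
        using reflector_radius_cell i by blast
    qed
  qed
  moreover have "?\<rho> z > 0" if "z \<in> closure \<Omega>" for z
    using reflector_radius_attained[of w z] radius_pos[OF w _ norm_closure[OF that]] by metis
  ultimately have "is_outer_unit_normal (reflector \<Omega> N P w) (?\<rho> x *\<^sub>R x) \<nu>
      \<longleftrightarrow> \<nu> = sgn (x - eccentricity (w i) (P i) *\<^sub>R sgn (P i))" for \<nu>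
    unfolding reflector_def using w i P_nonzero nx closure_subset_sphere
    by (intro is_outer_unit_normal_polar_iff) auto
  then show ?thesis unfolding reflector_normal_def by (intro the_equality) blast+
qed

lemma density_measurable [measurable]: "density w i \<in> borel_measurable sphere_measure"
proof -
  have 1: "(\<lambda>x. indicator (closure \<Omega>) x *\<^sub>R f x) \<in> borel_measurable sphere_measure"
    using f_integrable by (auto simp: set_integrable_def)
  have "(\<lambda>x. if \<forall>j\<in>{1..N}. radius w i x \<le> radius w j x then ellipsoid_weight (w i) (P i) x else 0)
      \<in> borel_measurable borel" by measurable
  then have "(\<lambda>x. (indicator (closure \<Omega>) x *\<^sub>R f x) *
      (if \<forall>j\<in>{1..N}. radius w i x \<le> radius w j x then ellipsoid_weight (w i) (P i) x else 0))
      \<in> borel_measurable sphere_measure"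
    by (intro borel_measurable_times 1 borel_measurable_sphere_measure)
  also have "(\<lambda>x. (indicator (closure \<Omega>) x *\<^sub>R f x) *
      (if \<forall>j\<in>{1..N}. radius w i x \<le> radius w j x then ellipsoid_weight (w i) (P i) x else 0)) = density w i"
    by (auto simp: density_def cell_def fun_eq_iff)
  finally show ?thesis .
qed

lemma density_bound:
  assumes "i \<in> {1..N}" "b > 0" "b \<le> w i"
  shows "norm (density w i x) \<le> norm (indicator (closure \<Omega>) x *\<^sub>R f x) * (4 / b\<^sup>2)"
proof (cases "x \<in> cell w i")
  case True
  then have x: "x \<in> closure \<Omega>" "norm x = 1" using norm_closure by (auto simp: cell_def)
  have "0 < ellipsoid_weight (w i) (P i) x" "ellipsoid_weight (w i) (P i) x \<le> 4 / b\<^sup>2"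
    using ellipsoid_weight_pos[of "P i" "w i" x] ellipsoid_weight_le[of "P i" b "w i" x] P_nonzero assms x by auto
  then have "\<bar>f x\<bar> * ellipsoid_weight (w i) (P i) x \<le> \<bar>f x\<bar> * (4 / b\<^sup>2)"
    by (intro mult_left_mono) auto
  then show ?thesis using True x \<open>0 < ellipsoid_weight (w i) (P i) x\<close> by (simp add: density_def abs_mult)
qed (simp add: density_def)

lemma dominating_integrable:
  "integrable sphere_measure (\<lambda>x. norm (indicator (closure \<Omega>) x *\<^sub>R f x) * K)"
  using f_integrable unfolding set_integrable_def
  by (intro integrable_mult_left integrable_norm) simp

lemma density_integrable:
  assumes "positive w" "i \<in> {1..N}"
  shows "integrable sphere_measure (density w i)"
  by (rule Bochner_Integration.integrable_bound[OF dominating_integrable[of "4 / (w i)\<^sup>2"] density_measurable])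
    (use assms density_bound[of i "w i" w] in \<open>auto intro!: AE_I2 simp: abs_mult\<close>)

lemma density_nonneg:
  assumes "positive w" "i \<in> {1..N}"
  shows "AE x in sphere_measure. 0 \<le> density w i x"
  using f_pos
proof eventually_elim
  case (elim x)
  then show ?case
    using ellipsoid_weight_pos[of "P i" "w i" x] P_nonzero assms norm_closure[of x]
    by (auto simp: density_def cell_def intro!: mult_nonneg_nonneg)
qed

text \<open>At a generic point at most one summand is nonzero, so the sum of densities equals the
  integrand extended by zero; additivity over points follows without any disjointness of the tracing
  sets themselves.\<close>

lemma reflector_measure_image:
  assumes w: "positive w" and I: "I \<subseteq> {1..N}"
  shows "reflector_measure \<Omega> f N P w (P ` I) = (\<Sum>i\<in>I. LINT x|sphere_measure. density w i x)"
proof -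
  define h where "h x = indicator (\<Union>Q\<in>P ` I. tracing_map \<Omega> N P w Q) x *\<^sub>R
    (f x * ((x \<bullet> reflector_normal \<Omega> N P w x) / (reflector_radius N P w x)\<^sup>2))" for x
  have finI: "finite I" using I finite_subset by blast
  have "AE x in sphere_measure. \<forall>i\<in>I. x \<in> tracing_map \<Omega> N P w (P i) \<longleftrightarrow> x \<in> cell w i"
    using AE_tracing_map_iff_cell[OF w] I by (intro AE_finite_allI finI) auto
  then have eq: "AE x in sphere_measure. (\<Sum>i\<in>I. density w i x) = h x"
    using AE_generic[OF w]
  proof eventually_elim
    case (elim x)
    show ?case
    proof (cases "\<exists>i\<in>I. x \<in> cell w i")
      case True
      then obtain i where i: "i \<in> I" "x \<in> cell w i" by auto
      then have iN: "i \<in> {1..N}" and g: "generic w x" using I elim by (auto simp: cell_def)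
      have "(\<Sum>j\<in>I. density w j x) = (\<Sum>j\<in>{i}. density w j x)"
        using generic_cell_unique(2)[OF g i(2) iN] i I finI
        by (intro sum.mono_neutral_right) (auto simp: density_def)
      also have "\<dots> = f x * ellipsoid_weight (w i) (P i) x" using i by (simp add: density_def)
      also have "\<dots> = h x"
      proof -
        have "x \<in> (\<Union>Q\<in>P ` I. tracing_map \<Omega> N P w Q)" using elim(1) i by auto
        then show ?thesis
          unfolding h_def reflector_normal_cell[OF w iN i(2) g] reflector_radius_cell[OF i(2) iN]
          by (simp add: ellipsoid_weight_def)
      qed
      finally show ?thesis .
    next
      case False
      then show ?thesis using elim by (simp add: density_def h_def)
    qed
  qed
  have m: "(\<lambda>x. \<Sum>i\<in>I. density w i x) \<in> borel_measurable sphere_measure" by measurable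
  have "reflector_measure \<Omega> f N P w (P ` I) = (LINT x|sphere_measure. h x)"
    by (simp add: reflector_measure_def set_lebesgue_integral_def h_def)
  also have "\<dots> = (LINT x|sphere_measure. (\<Sum>i\<in>I. density w i x))"
    using eq complete_measure.borel_measurable_AE_cong[OF complete_sphere_measure m eq]
    by (intro integral_cong_AE m) auto
  also have "\<dots> = (\<Sum>i\<in>I. LINT x|sphere_measure. density w i x)"
    using density_integrable[OF w] I by (intro Bochner_Integration.integral_sum) auto
  finally show ?thesis .
qed

lemma reflector_measure_point:
  assumes "positive w" "i \<in> {1..N}"
  shows "reflector_measure \<Omega> f N P w {P i} = (LINT x|sphere_measure. density w i x)"
  using reflector_measure_image[OF assms(1), of "{i}"] assms(2) by simp

section \<open>Monotonicity and continuity of the cell integrals\<close>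

lemma cell_mono:
  assumes "positive w" "positive w'" "i \<in> {1..N}" "w i = w' i" "\<And>j. j \<in> {1..N} \<Longrightarrow> w j \<le> w' j"
  shows "cell w i \<subseteq> cell w' i"
proof
  fix x assume x: "x \<in> cell w i"
  then have xO: "x \<in> closure \<Omega>" by (simp add: cell_def)
  have "radius w' i x \<le> radius w' j x" if j: "j \<in> {1..N}" for j
  proof -
    have "radius w i x \<le> radius w j x" using x j by (simp add: cell_def)
    also have "\<dots> \<le> radius w' j x"
      using polar_radius_le_iff[of "P j" x "w j" "w' j"] norm_closure[OF xO] P_nonzero assms j by simp
    finally show ?thesis using assms(4) by simp
  qed
  then show "x \<in> cell w' i" using xO by (simp add: cell_def)
qed

lemma density_mono:
  assumes "positive w" "positive w'" "i \<in> {1..N}" "w i = w' i" "\<And>j. j \<in> {1..N} \<Longrightarrow> w j \<le> w' j"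
  shows "AE x in sphere_measure. density w i x \<le> density w' i x"
  using density_nonneg[OF assms(2,3)]
proof eventually_elim
  case (elim x)
  then show ?case using cell_mono[OF assms] assms(4) by (auto simp: density_def)
qed

lemma integral_density_mono:
  assumes "positive w" "positive w'" "i \<in> {1..N}" "w i = w' i" "\<And>j. j \<in> {1..N} \<Longrightarrow> w j \<le> w' j"
  shows "(LINT x|sphere_measure. density w i x) \<le> (LINT x|sphere_measure. density w' i x)"
  using assms by (intro integral_mono_AE density_integrable density_mono) auto

text \<open>At a tie-free point of \<open>closure \<Omega>\<close>, strict inequalities between
  limiting radii persist for large \<open>n\<close>. Membership in the cell is thus eventually
  constant, and only the continuous weight still varies.\<close>

lemma density_tendsto:
  assumes w: "positive w" and lim: "\<And>j. j \<in> {1..N} \<Longrightarrow> (\<lambda>n. u n j) \<longlonglongrightarrow> w j"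
    and i: "i \<in> {1..N}" and g: "x \<in> closure \<Omega> \<Longrightarrow> generic w x"
  shows "(\<lambda>n. density (u n) i x) \<longlonglongrightarrow> density w i x"
proof (cases "x \<in> closure \<Omega>")
  case False
  then show ?thesis by (simp add: density_def cell_def)
next
  case x: True
  have rad: "(\<lambda>n. radius (u n) j x) \<longlonglongrightarrow> radius w j x" if "j \<in> {1..N}" for j
    using that w lim by (intro tendsto_polar_radius P_nonzero norm_closure x) auto
  have less: "eventually (\<lambda>n. radius (u n) j x < radius (u n) k x) sequentially"
    if "radius w j x < radius w k x" "j \<in> {1..N}" "k \<in> {1..N}" for j k
  proof -
    have "eventually (\<lambda>n. 0 < radius (u n) k x - radius (u n) j x) sequentially"
      using order_tendstoD(1)[OF tendsto_diff[OF rad rad], of k j 0] that by simp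
    then show ?thesis by eventually_elim simp
  qed
  show ?thesis
  proof (cases "x \<in> cell w i")
    case True
    have "eventually (\<lambda>n. \<forall>j\<in>{1..N}. radius (u n) i x \<le> radius (u n) j x) sequentially"
    proof (intro eventually_ball_finite ballI finite_atLeastAtMost)
      fix j assume j: "j \<in> {1..N}"
      show "eventually (\<lambda>n. radius (u n) i x \<le> radius (u n) j x) sequentially"
      proof (cases "j = i")
        case False
        then have "radius w i x < radius w j x"
          using generic_cell_unique(1)[OF g[OF x] True i j] by simp
        from less[OF this i j] show ?thesis by eventually_elim simp
      qed simp
    qed
    then have "eventually (\<lambda>n. f x * ellipsoid_weight (u n i) (P i) x = density (u n) i x) sequentially"
      by eventually_elim (use x in \<open>simp add: density_def cell_def\<close>)
    moreover have "(\<lambda>n. f x * ellipsoid_weight (u n i) (P i) x) \<longlonglongrightarrow> f x * ellipsoid_weight (w i) (P i) x"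
      using i w lim by (intro tendsto_mult tendsto_const tendsto_ellipsoid_weight P_nonzero norm_closure x) auto
    ultimately have "(\<lambda>n. density (u n) i x) \<longlonglongrightarrow> f x * ellipsoid_weight (w i) (P i) x"
      by (rule Lim_transform_eventually[rotated])
    then show ?thesis using True by (simp add: density_def)
  next
    case False
    then obtain j where j: "j \<in> {1..N}" "radius w j x < radius w i x"
      using generic_not_cell[OF x _ i] by blast
    from less[OF j(2,1) i] have ev: "eventually (\<lambda>n. 0 = density (u n) i x) sequentially"
    proof eventually_elim
      case (elim n)
      then have "x \<notin> cell (u n) i" using j(1) by (auto simp: cell_def not_le)
      then show ?case by (simp add: density_def)
    qed
    have "density w i x = 0" using False by (simp add: density_def)
    then show ?thesis using Lim_transform_eventually[OF tendsto_const ev] by simp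
  qed
qed

lemma integral_density_tendsto:
  assumes b: "b > 0" and u: "\<And>n j. j \<in> {1..N} \<Longrightarrow> b \<le> u n j"
    and lim: "\<And>j. j \<in> {1..N} \<Longrightarrow> (\<lambda>n. u n j) \<longlonglongrightarrow> w j" and i: "i \<in> {1..N}"
  shows "(\<lambda>n. LINT x|sphere_measure. density (u n) i x) \<longlonglongrightarrow> (LINT x|sphere_measure. density w i x)"
proof -
  have w: "positive w"
  proof
    fix j assume j: "j \<in> {1..N}"
    then have "b \<le> w j" using u by (intro LIMSEQ_le_const[OF lim]) auto
    then show "w j > 0" using b by simp
  qed
  show ?thesis
  proof (rule integral_dominated_convergence[OF density_measurable density_measurable
        dominating_integrable[of "4 / b\<^sup>2"]])
    show "AE x in sphere_measure. (\<lambda>n. density (u n) i x) \<longlonglongrightarrow> density w i x"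
      using AE_generic[OF w] by eventually_elim (use density_tendsto[OF w lim i] in auto)
    show "AE x in sphere_measure. norm (density (u n) i x) \<le> norm (indicator (closure \<Omega>) x *\<^sub>R f x) * (4 / b\<^sup>2)" for n
      using density_bound[of i b "u n"] u[of i n] i b by simp
  qed
qed

section \<open>Subsolutions and their infimum\<close>

definition subsolutions :: "real \<Rightarrow> real \<Rightarrow> (nat \<Rightarrow> real) \<Rightarrow> (nat \<Rightarrow> real) set" where
  "subsolutions a b g = {w. w 1 = a \<and>
     (\<forall>i\<in>{2..N}. w i \<ge> b \<and> reflector_measure \<Omega> f N P w {P i} \<le> g i)}"

context
  fixes a b :: real and g :: "nat \<Rightarrow> real"
  assumes a: "a > 0" and b: "b > 0"
begin

lemma subsolutions_ge: "\<lbrakk>w \<in> subsolutions a b g; i \<in> {1..N}\<rbrakk> \<Longrightarrow> min a b \<le> w i"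
  by (cases "i = 1") (auto simp: subsolutions_def min_le_iff_disj)

lemma subsolutions_positive: "w \<in> subsolutions a b g \<Longrightarrow> positive w"
  using subsolutions_ge a b by (metis less_le_trans min_less_iff_conj)

text \<open>At index \<open>i\<close> the minimum equals one of \<open>u\<close> and
  \<open>v\<close>. Relative to that one the other parameters have only decreased, so the i-th mass
  stays at most \<open>g i\<close>.\<close>

lemma subsolutions_min:
  assumes u: "u \<in> subsolutions a b g" and v: "v \<in> subsolutions a b g"
  shows "(\<lambda>j. min (u j) (v j)) \<in> subsolutions a b g"
proof -
  let ?m = "\<lambda>j. min (u j) (v j)"
  have pos: "positive u" "positive v" "positive ?m"
    using subsolutions_positive u v by auto
  have "reflector_measure \<Omega> f N P ?m {P i} \<le> g i" if i2: "i \<in> {2..N}" for i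
  proof -
    have i: "i \<in> {1..N}" using i2 by auto
    have aux: ?thesis if "w \<in> subsolutions a b g" "?m i = w i" "\<And>j. ?m j \<le> w j" for w
      using integral_density_mono[OF pos(3) subsolutions_positive[OF that(1)] i that(2,3)] that(1) i2
        reflector_measure_point[OF subsolutions_positive[OF that(1)] i] reflector_measure_point[OF pos(3) i]
      by (force simp: subsolutions_def)
    show ?thesis using aux[OF u] aux[OF v] by (cases "u i \<le> v i") auto
  qed
  then show ?thesis using u v by (auto simp: subsolutions_def)
qed

lemma subsolutions_Min:
  assumes "finite F" "F \<noteq> {}" "F \<subseteq> subsolutions a b g"
  shows "(\<lambda>j. Min ((\<lambda>w. w j) ` F)) \<in> subsolutions a b g"
  using assms
proof (induction rule: finite_ne_induct)
  case (insert w F)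
  then show ?case using subsolutions_min[of w "\<lambda>j. Min ((\<lambda>w. w j) ` F)"] by simp
qed simp

lemma subsolutions_closed:
  assumes u: "\<And>n. u n \<in> subsolutions a b g"
    and lim: "\<And>j. j \<in> {1..N} \<Longrightarrow> (\<lambda>n. u n j) \<longlonglongrightarrow> w j"
  shows "w \<in> subsolutions a b g"
proof -
  have one: "1 \<in> {1..N}" using N_pos by simp
  have ge: "min a b \<le> w j" if "j \<in> {1..N}" for j
    using subsolutions_ge[OF u that] by (intro LIMSEQ_le_const[OF lim[OF that]]) auto
  have w: "positive w"
  proof
    fix j assume "j \<in> {1..N}"
    then show "w j > 0" using ge[of j] a b by (simp add: min_le_iff_disj) linarith
  qed
  have "w 1 = a"
    using lim[OF one] u by (simp add: subsolutions_def LIMSEQ_const_iff)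
  moreover have "b \<le> w i \<and> reflector_measure \<Omega> f N P w {P i} \<le> g i" if i2: "i \<in> {2..N}" for i
  proof
    have i: "i \<in> {1..N}" using i2 by auto
    show "b \<le> w i" using u i2 by (intro LIMSEQ_le_const[OF lim[OF i]]) (auto simp: subsolutions_def)
    have "(LINT x|sphere_measure. density (u n) i x) \<le> g i" for n
    proof -
      have "reflector_measure \<Omega> f N P (u n) {P i} \<le> g i" using u[of n] i2 by (simp add: subsolutions_def)
      then show ?thesis by (simp add: reflector_measure_point[OF subsolutions_positive[OF u] i])
    qed
    then have "(LINT x|sphere_measure. density w i x) \<le> g i"
      using integral_density_tendsto[of "min a b" u w i] subsolutions_ge[OF u] lim i a b
      by (intro LIMSEQ_le_const2) auto
    then show "reflector_measure \<Omega> f N P w {P i} \<le> g i" by (simp add: reflector_measure_point[OF w i])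
  qed
  ultimately show ?thesis by (simp add: subsolutions_def)
qed

text \<open>The infima are taken separately in each coordinate, so a priori no single sequence of
  subsolutions approaches all of them. Finite minima of near-minimisers, one per coordinate, provide
  such a sequence.\<close>

lemma subsolutions_Inf:
  assumes N: "N > 1" and d: "d \<in> subsolutions a b g"
    and m1: "m 1 = a" and m: "\<And>i. i \<in> {2..N} \<Longrightarrow> m i = (INF w\<in>subsolutions a b g. w i)"
  shows "m \<in> subsolutions a b g" "\<And>w i. \<lbrakk>w \<in> subsolutions a b g; i \<in> {1..N}\<rbrakk> \<Longrightarrow> m i \<le> w i"
proof -
  let ?W = "subsolutions a b g"
  have bdd: "bdd_below ((\<lambda>w. w i) ` ?W)" if "i \<in> {2..N}" for i
    using that by (intro bdd_belowI[of _ b]) (auto simp: subsolutions_def)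
  show le: "m i \<le> w i" if w: "w \<in> ?W" and i: "i \<in> {1..N}" for w i
  proof (cases "i = 1")
    case True
    then show ?thesis using w m1 by (simp add: subsolutions_def)
  next
    case False
    then have i2: "i \<in> {2..N}" using i by auto
    then show ?thesis using m[OF i2] cINF_lower[OF bdd[OF i2] w] by simp
  qed
  have "\<exists>w\<in>?W. w i < m i + inverse (real (Suc n))" if i: "i \<in> {2..N}" for i n
  proof -
    have "(INF w\<in>?W. w i) < m i + inverse (real (Suc n))" unfolding m[OF i, symmetric] by simp
    then show ?thesis using cINF_less_iff[OF _ bdd[OF i]] d by blast
  qed
  then have "\<forall>n. \<forall>i\<in>{2..N}. \<exists>w\<in>?W. w i < m i + inverse (real (Suc n))" by blast
  then have "\<exists>u. \<forall>n. \<forall>i\<in>{2..N}. u n i \<in> ?W \<and> u n i i < m i + inverse (real (Suc n))"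
    by (subst choice_iff[symmetric], subst bchoice_iff[symmetric]) blast
  then obtain u where u: "\<And>n i. i \<in> {2..N} \<Longrightarrow> u n i \<in> ?W"
    "\<And>n i. i \<in> {2..N} \<Longrightarrow> u n i i < m i + inverse (real (Suc n))" by blast
  \<comment> \<open>\<open>u n i\<close> is within \<open>1 / (n + 1)\<close> of the infimum in
    coordinate \<open>i\<close>, so \<open>v n\<close> is within that distance in all coordinates
    from 2 on. The \<open>Min\<close> is over a nonempty set because \<open>N > 1\<close>.\<close>
  define v where "v n j = Min ((\<lambda>w. w j) ` (u n ` {2..N}))" for n j
  have v: "v n \<in> ?W" for n
    unfolding v_def using N u(1) by (intro subsolutions_Min) auto
  have "(\<lambda>n. v n j) \<longlonglongrightarrow> m j" if j: "j \<in> {1..N}" for j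
  proof (cases "j = 1")
    case True
    then show ?thesis using v m1 by (simp add: subsolutions_def)
  next
    case False
    then have j2: "j \<in> {2..N}" using j by auto
    have upper: "v n j \<le> m j + inverse (real (Suc n))" for n
    proof -
      have "v n j \<le> u n j j" unfolding v_def using j2 by (intro Min_le) auto
      then show ?thesis using u(2)[OF j2, of n] by simp
    qed
    have "(\<lambda>n. m j + inverse (real (Suc n))) \<longlonglongrightarrow> m j + 0"
      by (intro tendsto_add tendsto_const LIMSEQ_inverse_real_of_nat)
    then have "(\<lambda>n. m j + inverse (real (Suc n))) \<longlonglongrightarrow> m j" by (simp only: add_0_right)
    with tendsto_const show ?thesis
      by (rule tendsto_sandwich[rotated 2]) (use le[OF v j] upper in \<open>simp_all only: eventually_True\<close>)
  qed
  then show "m \<in> ?W" by (rule subsolutions_closed[OF v])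
qed

end

section \<open>The equality case\<close>

text \<open>Ordered densities with equal integrals agree almost everywhere. On the larger cell the
  density is almost everywhere positive, so the smaller cell cannot miss a non-null part of
  it.\<close>

lemma cell_eq_AE:
  assumes "positive w" "positive w'" "i \<in> {1..N}" "w i = w' i" "\<And>j. j \<in> {1..N} \<Longrightarrow> w j \<le> w' j"
    and eq: "(LINT x|sphere_measure. density w i x) = (LINT x|sphere_measure. density w' i x)"
  shows "AE x in sphere_measure. x \<in> cell w' i \<longrightarrow> x \<in> cell w i"
proof -
  have int: "integrable sphere_measure (density w i)" "integrable sphere_measure (density w' i)"
    using density_integrable assms by auto
  have "AE x in sphere_measure. 0 \<le> density w' i x - density w i x"
    using density_mono[of w w' i] assms(1-5) by (auto elim: eventually_mono)
  moreover have "(LINT x|sphere_measure. density w' i x - density w i x) = 0"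
    using int eq by simp
  ultimately have "AE x in sphere_measure. density w' i x - density w i x = 0"
    using integral_nonneg_eq_0_iff_AE[OF Bochner_Integration.integrable_diff[OF int(2,1)]] by blast
  then show ?thesis using f_pos
  proof eventually_elim
    case (elim x)
    then show ?case
      using ellipsoid_weight_pos[of "P i" "w' i" x] P_nonzero assms(2,3) norm_closure[of x]
      by (auto simp: density_def cell_def split: if_splits)
  qed
qed

text \<open>An open set meeting \<open>closure \<Omega>\<close> meets \<Omega>, then by regularity
  its interior, and so contains a patch of the sphere inside \<Omega>.\<close>

lemma not_null_relatively_open:
  assumes regular: "\<Omega> \<subseteq> (top_of_set S2) closure_of ((top_of_set S2) interior_of \<Omega>)"
    and V: "openin (top_of_set (closure \<Omega>)) V" "V \<noteq> {}"
  shows "V \<notin> null_sets sphere_measure"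
proof -
  let ?I = "(top_of_set S2) interior_of \<Omega>"
  obtain U where U: "open U" "V = closure \<Omega> \<inter> U" using V by (auto simp: openin_open)
  then have "\<Omega> \<inter> U \<noteq> {}" using V open_Int_closure_eq_empty[of U \<Omega>] by (auto simp: Int_commute)
  then obtain y where y: "y \<in> \<Omega>" "y \<in> U" by auto
  then have "y \<in> closure ?I" using regular closure_of_subtopology_subset[of euclidean S2 ?I] by auto
  then have "U \<inter> ?I \<noteq> {}" using open_Int_closure_eq_empty[OF U(1), of ?I] y(2) by blast
  then obtain z where z: "z \<in> U" "z \<in> ?I" by auto
  then obtain T where T: "openin (top_of_set S2) T" "z \<in> T" "T \<subseteq> \<Omega>" by (auto simp: interior_of_def)
  then obtain T' where "open T'" "T = S2 \<inter> T'" by (auto simp only: openin_open)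
  then have T': "open T'" "z \<in> T'" "z \<in> S2" "T' \<inter> S2 \<subseteq> \<Omega>" using T by blast+
  show ?thesis
    by (rule open_not_null_sets_sphere_measure[of "U \<inter> T'"]) (use U z T' closure_subset[of \<Omega>] in auto)
qed

lemma closed_cell:
  assumes "positive w" "i \<in> {1..N}"
  shows "closed (cell w i)"
proof -
  have cont: "continuous_on (closure \<Omega>) (radius w j)" if "j \<in> {1..N}" for j
    using assms(1) that isCont_polar_radius P_nonzero norm_closure
    by (intro continuous_at_imp_continuous_on ballI) auto
  have "closed (\<Inter>j\<in>{1..N}. {x \<in> closure \<Omega>. radius w i x \<le> radius w j x})"
    using assms(2) by (intro closed_INT ballI continuous_on_closed_Collect_le cont closed_closure)
  also have "(\<Inter>j\<in>{1..N}. {x \<in> closure \<Omega>. radius w i x \<le> radius w j x}) = cell w i"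
    using assms(2) by (auto simp: cell_def)
  finally show ?thesis .
qed

text \<open>Let \<open>J\<close> be the set of indices at which the parameters differ. The part of the reflector
  \<open>w'\<close> outside the \<open>J\<close>-cells is relatively open, and up to a null set it is the part of \<open>w\<close>
  covered by the remaining cells, which is closed; hence it is clopen.\<close>

lemma rigidity:
  assumes conn: "connected (closure \<Omega>)"
    and regular: "\<Omega> \<subseteq> (top_of_set S2) closure_of ((top_of_set S2) interior_of \<Omega>)"
    and w: "positive w" and w': "positive w'" and le: "\<And>j. j \<in> {1..N} \<Longrightarrow> w j \<le> w' j"
    and eq: "\<And>i. i \<in> {1..N} \<Longrightarrow> (LINT x|sphere_measure. density w i x) = (LINT x|sphere_measure. density w' i x)"
    and pos: "\<And>i. i \<in> {1..N} \<Longrightarrow> (LINT x|sphere_measure. density w' i x) > 0"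
    and i0: "i0 \<in> {1..N}" "w i0 = w' i0" and i: "i \<in> {1..N}"
  shows "w i = w' i"
proof (rule ccontr)
  assume ne: "w i \<noteq> w' i"
  define I where "I = {j\<in>{1..N}. w j = w' j}"
  define J where "J = {j\<in>{1..N}. w j \<noteq> w' j}"
  define F where "F = (\<Union>k\<in>I. cell w k)"
  define G where "G = closure \<Omega> - (\<Union>j\<in>J. cell w' j)"
  have IJ: "I \<subseteq> {1..N}" "J \<subseteq> {1..N}" "finite I" "finite J" by (auto simp: I_def J_def)
  have "closed F" unfolding F_def using closed_cell[OF w] IJ by (intro closed_UN) auto
  have "closed (\<Union>j\<in>J. cell w' j)" using closed_cell[OF w'] IJ by (intro closed_UN) auto
  then have openG: "openin (top_of_set (closure \<Omega>)) G"
    unfolding G_def Diff_eq openin_open by blast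
  have FG: "F \<subseteq> G"
  proof
    fix x assume "x \<in> F"
    then obtain k where k: "k \<in> I" "x \<in> cell w k" by (auto simp: F_def)
    then have x: "x \<in> closure \<Omega>" by (simp add: cell_def)
    \<comment> \<open>Index \<open>k\<close> keeps its radius while that of \<open>j\<close>
      strictly increases from \<open>w\<close> to \<open>w'\<close>. As \<open>j\<close> could at
      best tie with \<open>k\<close> before, it now loses strictly.\<close>
    have "x \<notin> cell w' j" if j: "j \<in> J" for j
    proof -
      have "radius w k x \<le> radius w j x" using k j by (simp add: cell_def J_def)
      also have "\<dots> < radius w' j x"
        using polar_radius_less_iff[of "P j" x "w j" "w' j"] norm_closure[OF x] P_nonzero w w' le[of j] j
        by (simp add: J_def)
      finally have "radius w' k x < radius w' j x" using k by (simp add: I_def)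
      then show ?thesis using k IJ by (auto simp: cell_def not_le)
    qed
    then show "x \<in> G" using x by (auto simp: G_def)
  qed
  have "AE x in sphere_measure. \<forall>k\<in>I. x \<in> cell w' k \<longrightarrow> x \<in> cell w k"
    using IJ by (intro AE_finite_allI cell_eq_AE w w' le eq) (auto simp: I_def)
  then have "AE x in sphere_measure. x \<notin> G - F"
  proof eventually_elim
    case (elim x)
    show ?case
    proof
      assume x: "x \<in> G - F"
      then have "x \<in> closure \<Omega>" by (simp add: G_def)
      then obtain k where k: "k \<in> {1..N}" "x \<in> cell w' k" by (rule cell_cover)
      then have "k \<in> I" using x by (auto simp: G_def I_def J_def)
      then show False using elim k x by (auto simp: F_def)
    qed
  qed
  then have "G - F \<in> null_sets sphere_measure"
    using closure_subset_sphere
    by (auto simp: complete_measure.null_sets_iff_AE[OF complete_sphere_measure] G_def)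
  moreover have "openin (top_of_set (closure \<Omega>)) (G - F)"
    using openG \<open>closed F\<close> by (metis Diff_Diff_Int Diff_eq openin_Int_open open_Compl)
  ultimately have "G - F = {}" using not_null_relatively_open[OF regular] by blast
  then have "G = F" using FG by blast
  then have "closedin (top_of_set (closure \<Omega>)) G"
    using \<open>closed F\<close> by (intro closed_subset) (auto simp: G_def)
  then have "G = {} \<or> G = closure \<Omega>" using conn openG by (auto simp: connected_clopen)
  \<comment> \<open>An empty \<open>G\<close> leaves no mass at the unchanged index
    \<open>i0\<close>, and a full \<open>G\<close> leaves none at the changed index
    \<open>i\<close>; both contradict positivity.\<close>
  then show False
  proof
    assume "G = {}"
    then have "cell w i0 = {}" using \<open>G = F\<close> i0 by (auto simp: F_def I_def)
    then have "(LINT x|sphere_measure. density w i0 x) = 0" by (simp add: density_def)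
    then show False using eq[OF i0(1)] pos[OF i0(1)] by simp
  next
    assume "G = closure \<Omega>"
    have "i \<in> J" using i ne by (simp add: J_def)
    then have "cell w' i \<inter> G = {}" unfolding G_def by blast
    moreover have "cell w' i \<subseteq> closure \<Omega>" by (auto simp: cell_def)
    ultimately have "cell w' i = {}" using \<open>G = closure \<Omega>\<close> by blast
    then have "(LINT x|sphere_measure. density w' i x) = 0" by (simp add: density_def)
    then show False using pos[OF i] by simp
  qed
qed

section \<open>Lower bound for the total mass\<close>

text \<open>On every cell the active radius is at most that of the first ellipsoid, hence at most
  \<open>R / (1 - c)\<close>, however large the other parameters are. With the bound
  \<open>(1 - c) / (1 + c)\<close> for the normal factor this gives \<open>?C\<close>, which for
  \<open>R = k * \<delta> * M\<close> is the constant \<open>C\<close> of the theorem.\<close>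

lemma total_mass_ge:
  assumes w: "positive w" and c: "c < 1" and R: "w 1 \<le> R"
    and ecc: "\<And>i. i \<in> {1..N} \<Longrightarrow> eccentricity (w i) (P i) \<le> c"
  shows "(1 - c) ^ 3 / ((1 + c) * R\<^sup>2) * (LINT x:closure \<Omega>|sphere_measure. f x)
    \<le> (\<Sum>i=1..N. LINT x|sphere_measure. density w i x)"
proof -
  have one: "1 \<in> {1..N}" using N_pos by simp
  have c0: "0 < c" using ecc[OF one] eccentricity_equation(2)[of "P 1" "w 1"] P_nonzero[OF one] w one by fastforce
  have R0: "R > 0" using R w one by fastforce
  let ?C = "(1 - c) ^ 3 / ((1 + c) * R\<^sup>2)"
  have weight: "?C \<le> ellipsoid_weight (w i) (P i) x" if x: "x \<in> cell w i" and i: "i \<in> {1..N}" for x i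
  proof -
    define e where "e = eccentricity (w i) (P i)"
    have nx: "norm x = 1" using x norm_closure by (simp add: cell_def)
    have e: "0 < e" "e \<le> c" using eccentricity_equation(2)[of "P i" "w i"] P_nonzero[OF i] w i ecc[OF i]
      by (auto simp: e_def)
    have "(1 - c) / (1 + c) \<le> (1 - e) / (1 + e)" using e c by (intro frac_le) auto
    also have "\<dots> \<le> x \<bullet> sgn (x - e *\<^sub>R sgn (P i))"
      unfolding e_def using w i by (intro inner_ellipsoid_normal_bounds(1) P_nonzero nx) auto
    finally have 1: "(1 - c) / (1 + c) \<le> x \<bullet> sgn (x - e *\<^sub>R sgn (P i))" .
    moreover have "0 \<le> (1 - c) / (1 + c)" using c c0 by simp
    ultimately have 2: "0 \<le> x \<bullet> sgn (x - e *\<^sub>R sgn (P i))" by (rule order_trans[rotated])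
    have "radius w i x \<le> radius w 1 x" using x one by (simp add: cell_def)
    also have "radius w 1 x \<le> R / (1 - c)"
      unfolding polar_radius_def
      using polar_denominator_bounds(1)[of "P 1" "w 1" x] P_nonzero[OF one] w one nx ecc[OF one] c R R0
      by (intro frac_le) auto
    finally have "(radius w i x)\<^sup>2 \<le> (R / (1 - c))\<^sup>2"
      using radius_pos[OF w i nx] by (intro power_mono) auto
    then have "((1 - c) / (1 + c)) / (R / (1 - c))\<^sup>2 \<le> ellipsoid_weight (w i) (P i) x"
      unfolding ellipsoid_weight_def using 1 2 radius_pos[OF w i nx] c c0
      by (intro frac_le) (auto simp: e_def)
    moreover have "((1 - c) / (1 + c)) / (R / (1 - c))\<^sup>2 = ?C"
      by (simp add: power_divide power2_eq_square power3_eq_cube mult_ac)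
    ultimately show ?thesis by simp
  qed
  have "AE x in sphere_measure. \<forall>i\<in>{1..N}. 0 \<le> density w i x"
    using density_nonneg[OF w] by (intro AE_finite_allI) auto
  then have "AE x in sphere_measure. ?C * (indicator (closure \<Omega>) x *\<^sub>R f x) \<le> (\<Sum>i=1..N. density w i x)"
    using f_pos
  proof eventually_elim
    case (elim x)
    show ?case
    proof (cases "x \<in> closure \<Omega>")
      case True
      then obtain i where i: "i \<in> {1..N}" "x \<in> cell w i" by (rule cell_cover)
      have "?C * f x \<le> ellipsoid_weight (w i) (P i) x * f x"
        using weight[OF i(2,1)] elim True by (intro mult_right_mono) auto
      also have "\<dots> = density w i x" using i by (simp add: density_def mult.commute)
      also have "density w i x \<le> (\<Sum>i=1..N. density w i x)" using elim i by (intro member_le_sum) auto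
      finally show ?thesis using True by simp
    next
      case False
      then show ?thesis using elim by (auto intro!: sum_nonneg)
    qed
  qed
  then have "(LINT x|sphere_measure. ?C * (indicator (closure \<Omega>) x *\<^sub>R f x))
      \<le> (LINT x|sphere_measure. (\<Sum>i=1..N. density w i x))"
    using f_integrable density_integrable[OF w]
    by (intro integral_mono_AE integrable_mult_right Bochner_Integration.integrable_sum)
      (auto simp: set_integrable_def)
  then show ?thesis
    using density_integrable[OF w] by (simp add: set_lebesgue_integral_def Bochner_Integration.integral_sum)
qed

end


theorem theorem4p10:
  fixes \<Omega> :: "(real^3) set" and f :: "real^3 \<Rightarrow> real"
    and N :: nat and g :: "nat \<Rightarrow> real" and P :: "nat \<Rightarrow> real^3"
    and D :: "(real^3) set"
    and M \<delta> c k C :: real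
    and W \<C> :: "(nat \<Rightarrow> real) set"
    and dbar d :: "nat \<Rightarrow> real"
  assumes "\<Omega> \<subseteq> S2"
    and "(top_of_set S2) frontier_of \<Omega> \<in> null_sets sphere_measure"
    and "set_integrable sphere_measure (closure \<Omega>) f"
    and "AE x in sphere_measure. x \<in> closure \<Omega> \<longrightarrow> f x > 0"
    and "N > 1"
    and "\<forall>i\<in>{1..N}. g i > 0"
    and "inj_on P {1..N}"
    and "D = P ` {1..N}"
    and "0 \<notin> D"
    and "M = Max ((\<lambda>i. norm (P i)) ` {1..N})"
    and "\<delta> > 0"
    and "c = - \<delta> + sqrt (1 + \<delta>\<^sup>2)"
    and "k \<ge> (1 + c) / (1 - c)"
    and "C = (1 - c) ^ 3 / ((1 + c) * (k * \<delta> * M)\<^sup>2)"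
    and "(LINT x:closure \<Omega>|sphere_measure. f x) \<ge> 1 / C * target_measure N g P D"
    and "W = {w. w 1 = k * \<delta> * M \<and>
               (\<forall>i\<in>{2..N}. w i \<ge> \<delta> * M \<and> reflector_measure \<Omega> f N P w {P i} \<le> g i)}"
    and "\<C> = {w. w 1 = k * \<delta> * M \<and>
               (\<forall>i\<in>{2..N}. w i \<ge> \<delta> * M \<and> reflector_measure \<Omega> f N P w {P i} = g i)}"
    and "dbar 1 = k * \<delta> * M"
    and "\<forall>i\<in>{2..N}. dbar i = (INF w\<in>W. w i)"
    and "d \<in> \<C>"
  shows "reflector_measure \<Omega> f N P dbar D \<le> reflector_measure \<Omega> f N P d D \<and>
    (connected (closure \<Omega>) \<and>
     \<Omega> \<subseteq> (top_of_set S2) closure_of ((top_of_set S2) interior_of \<Omega>) \<and>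
     reflector_measure \<Omega> f N P dbar D = reflector_measure \<Omega> f N P d D
     \<longrightarrow> (\<forall>i\<in>{1..N}. dbar i = d i))"
proof -
  note \<Omega>_sub = assms(1) and frontier = assms(2) and f_int = assms(3) and f_pos = assms(4) and N = assms(5)
    and g = assms(6) and inj = assms(7) and D = assms(8) and D0 = assms(9) and M = assms(10)
    and \<delta> = assms(11) and c = assms(12) and k = assms(13) and C = assms(14) and mass = assms(15)
    and W = assms(16) and \<C> = assms(17) and dbar1 = assms(18) and dbar = assms(19) and d = assms(20)
  have P0: "P i \<noteq> 0" if "i \<in> {1..N}" for i using D D0 that by force
  interpret point_source_reflector \<Omega> f N P
    using \<Omega>_sub frontier f_int f_pos N inj P0 by unfold_locales auto
  have one: "1 \<in> {1..N}" using N by simp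
  have PM: "norm (P i) \<le> M" if "i \<in> {1..N}" for i
    unfolding M using that by (intro Max_ge) auto
  have M0: "M > 0" using PM[OF one] P0[OF one] by (smt (verit) zero_less_norm_iff)
  have "\<delta> < sqrt (1 + \<delta>\<^sup>2)" by (rule real_less_rsqrt) simp
  then have c0: "c > 0" by (simp add: c)
  \<comment> \<open>Exhibits \<open>c\<close> as the eccentricity at parameter \<delta> and focal
    distance 1. Since \<open>d i / norm (P i)\<close> is at least \<delta>, monotonicity then bounds
    every eccentricity by \<open>c\<close>.\<close>
  have c_ecc: "c = eccentricity \<delta> (axis 1 1)"
    by (simp add: c eccentricity_def norm_axis_1)
  have ax: "axis 1 (1::real) \<noteq> (0 :: real^3)" by (simp add: axis_eq_0_iff)
  have c1: "c < 1" using eccentricity_equation(3)[OF ax \<delta>] by (simp add: c_ecc)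
  have "1 \<le> (1 + c) / (1 - c)" using c0 c1 by simp
  \<comment> \<open>Gives \<open>b \<le> a\<close>, so the first parameter also obeys the lower
    bound \<open>\<delta> * M\<close> behind the eccentricity estimate.\<close>
  then have k1: "k \<ge> 1" using k by linarith
  define a where "a = k * \<delta> * M"
  define b where "b = \<delta> * M"
  have b0: "b > 0" using \<delta> M0 by (simp add: b_def)
  have ba: "b \<le> a" using b0 k1 by (simp add: a_def b_def mult.assoc mult_le_cancel_right1)
  then have a0: "a > 0" using b0 by simp
  have W_eq: "W = subsolutions a b g" by (simp add: W subsolutions_def a_def b_def)
  have d_eq: "reflector_measure \<Omega> f N P d {P i} = g i" if "i \<in> {2..N}" for i
    using d that by (simp add: \<C>)
  have dW: "d \<in> subsolutions a b g"
    using d by (auto simp: \<C> subsolutions_def a_def b_def)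
  have dbarW: "dbar \<in> subsolutions a b g"
    and le: "\<And>i. i \<in> {1..N} \<Longrightarrow> dbar i \<le> d i"
    using subsolutions_Inf[OF a0 b0 N dW, of dbar] dbar1 dbar dW by (simp_all add: W_eq a_def)
  note pos = subsolutions_positive[OF a0 b0 dbarW] subsolutions_positive[OF a0 b0 dW]
  define m where "m w i = (LINT x|sphere_measure. density w i x)" for w i
  have total: "reflector_measure \<Omega> f N P w D = (\<Sum>i=1..N. m w i)" if "positive w" for w
    unfolding D m_def using that by (rule reflector_measure_image) simp
  have mg: "m d i = g i" "m dbar i \<le> g i" if i: "i \<in> {2..N}" for i
  proof -
    have i1: "i \<in> {1..N}" using i by auto
    show "m d i = g i" using d_eq[OF i] reflector_measure_point[OF pos(2) i1] by (simp add: m_def)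
    have "reflector_measure \<Omega> f N P dbar {P i} \<le> g i" using dbarW i by (simp add: subsolutions_def)
    then show "m dbar i \<le> g i" using reflector_measure_point[OF pos(1) i1] by (simp add: m_def)
  qed
  have eq1: "dbar 1 = d 1" using dbarW dW by (simp add: subsolutions_def)
  \<comment> \<open>Only index 1, where the parameters agree, compares cells. At the other indices
    \<open>dbar\<close> is a subsolution and \<open>d\<close> attains \<open>g i\<close>
    exactly.\<close>
  have m_le: "m dbar i \<le> m d i" if i: "i \<in> {1..N}" for i
  proof (cases "i = 1")
    case True
    then show ?thesis using integral_density_mono[OF pos one eq1 le] by (simp add: m_def)
  next
    case False
    then have "i \<in> {2..N}" using i by auto
    then show ?thesis using mg by simp
  qed
  then have part1: "reflector_measure \<Omega> f N P dbar D \<le> reflector_measure \<Omega> f N P d D"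
    unfolding total[OF pos(1)] total[OF pos(2)] by (intro sum_mono) auto
  have part2: "\<forall>i\<in>{1..N}. dbar i = d i"
    if conn: "connected (closure \<Omega>)"
      and regular: "\<Omega> \<subseteq> (top_of_set S2) closure_of ((top_of_set S2) interior_of \<Omega>)"
      and eq: "reflector_measure \<Omega> f N P dbar D = reflector_measure \<Omega> f N P d D"
  proof -
    have "(\<Sum>i=1..N. m d i - m dbar i) = 0"
      using eq total[OF pos(1)] total[OF pos(2)] by (simp add: sum_subtractf)
    then have m_eq: "m dbar i = m d i" if "i \<in> {1..N}" for i
      using m_le that by (subst (asm) sum_nonneg_eq_0_iff) auto
    have ecc: "eccentricity (d i) (P i) \<le> c" if i: "i \<in> {1..N}" for i
    proof -
      have "b \<le> d i" using subsolutions_ge[OF a0 b0 dW i] ba by simp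
      moreover have "\<delta> * norm (P i) \<le> b" unfolding b_def using PM[OF i] \<delta> by simp
      ultimately have "\<delta> \<le> d i / norm (P i)" using P0[OF i] by (simp add: pos_le_divide_eq)
      then show ?thesis
        unfolding c_ecc using eccentricity_le_iff[OF P0[OF i] _ ax \<delta>, of "d i"] pos(2) i
        by (simp add: norm_axis_1)
    qed
    have "d 1 \<le> a" using dW by (simp add: subsolutions_def)
    have Cpos: "C > 0" using c0 c1 a0 unfolding C a_def[symmetric] by simp
    have "(\<Sum>i=1..N. g i) = target_measure N g P D" by (simp add: target_measure_def D)
    also have "\<dots> \<le> C * (LINT x:closure \<Omega>|sphere_measure. f x)"
      using mass Cpos by (simp add: field_simps)
    also have "\<dots> \<le> (\<Sum>i=1..N. m d i)"
      using total_mass_ge[OF pos(2) c1 \<open>d 1 \<le> a\<close> ecc] by (simp add: C a_def m_def)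
    \<comment> \<open>The masses of \<open>d\<close> at indices from 2 on are exactly the
      \<open>g i\<close> and cancel, leaving at least \<open>g 1\<close> for the first
      point.\<close>
    finally have "g 1 + (\<Sum>i=2..N. g i) \<le> m d 1 + (\<Sum>i=2..N. m d i)"
      using N by (simp add: sum.atLeast_Suc_atMost numeral_2_eq_2)
    then have "g 1 \<le> m d 1" using mg(1) by simp
    then have m_pos: "m d i > 0" if "i \<in> {1..N}" for i
      using mg(1)[of i] g that one by (cases "i = 1") force+
    show ?thesis
      using rigidity[OF conn regular pos le _ _ one eq1] m_eq m_pos by (simp add: m_def)
  qed
  show ?thesis using part1 part2 by blast
qed

end
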